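(* For any fixed $g<2$, one can decide in polynomial time if a $g$-bounded TS $A$ is $\tau$-solvable if $\tau=\{\mathsf{nop},\mathsf{inp},\mathsf{set}\}$ or $\tau=\{\mathsf{nop},\mathsf{inp},\mathsf{set},\mathsf{used}\}$ or $\tau=\{\mathsf{nop},\mathsf{out},\mathsf{res}\}$ or $\tau=\{\mathsf{nop},\mathsf{out},\mathsf{res},\mathsf{free}\}$ or $\tau=\{\mathsf{nop},\mathsf{set},\mathsf{res}\}\cup\omega$ with non-empty $\omega\subseteq\{\mathsf{inp},\mathsf{out},\mathsf{used},\mathsf{free}\}$.
   Context: A transition system (TS) $A=(S,E,\delta,s_0)$ is a directed labeled graph with states $S$, events $E$, a partial (deterministic) transition function $\delta:S\times E\to S$ and an initial state $s_0$ from which every state is reachable. For $g\in\mathbb{N}$, $A$ is $g$-bounded if every state has at most $g$ incoming and at most $g$ outgoing arcs. The Boolean interactions are the partial functions $\{0,1\}\to\{0,1\}$: $\mathsf{nop}$ ($0\mapsto0,1\mapsto1$), $\mathsf{inp}$ ($1\mapsto0$, undefined on $0$), $\mathsf{out}$ ($0\mapsto1$, undefined on $1$), $\mathsf{set}$ ($0,1\mapsto1$), $\mathsf{res}$ ($0,1\mapsto0$), $\mathsf{swap}$ ($0\mapsto1,1\mapsto0$), $\mathsf{used}$ ($1\mapsto1$, undefined on $0$), $\mathsf{free}$ ($0\mapsto0$, undefined on $1$). A Boolean type of net is a subset $\tau$ of these interactions. A $\tau$-net $N=(P,T,M_0,f)$ has places $P$, transitions $T$, initial marking $M_0:P\to\{0,1\}$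 and flow $f:P\times T\to\tau$; a transition $t$ fires in marking $M$ iff $f(p,t)(M(p))$ is defined for all $p$, producing $M'(p)=f(p,t)(M(p))$. A TS $A$ is $\tau$-solvable if it is isomorphic to the reachability graph of some $\tau$-net. *)

theory Defs
  imports Main "HOL-Library.FuncSet" "HOL-Library.Log_Nat" "HOL-Computational_Algebra.Polynomial"
begin

section \<open>Transition systems\<close>

record ('s, 'e) ts =
  states :: "'s set"
  events :: "'e set"
  delta :: "'s \<Rightarrow> 'e \<Rightarrow> 's option"
  init :: 's

definition arcs :: "('s, 'e, 'x) ts_scheme \<Rightarrow> ('s \<times> 'e \<times> 's) set" where
  "arcs A = {(s, e, s'). delta A s e = Some s'}"

definition reach :: "('s \<Rightarrow> 'e \<Rightarrow> 's option) \<Rightarrow> 's \<Rightarrow> 's set" where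
  "reach d s\<^sub>0 = {s. (s\<^sub>0, s) \<in> {(u, v). \<exists>e. d u e = Some v}\<^sup>*}"

text \<open>Transition systems are inputs of algorithms, so states and events are finite. Events
  without any occurrence are allowed. The second line makes \<open>delta\<close> a partial function
  from states and events to states, i.e. undefined elsewhere.\<close>

definition transition_system :: "('s, 'e) ts \<Rightarrow> bool" where
  "transition_system A \<longleftrightarrow>
     finite (states A) \<and> finite (events A) \<and>
     arcs A \<subseteq> states A \<times> events A \<times> states A \<and>
     init A \<in> states A \<and>
     states A \<subseteq> reach (delta A) (init A)"

definition bounded :: "nat \<Rightarrow> ('s, 'e) ts \<Rightarrow> bool" where
  "bounded g A \<longleftrightarrow> (\<forall>s \<in> states A.
     card {(s', e, s'') \<in> arcs A. s'' = s} \<le> g \<and>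
     card {(s', e, s'') \<in> arcs A. s' = s} \<le> g)"

text \<open>Isomorphism of edge-labelled rooted graphs: the labels are preserved.\<close>

definition ts_isomorphic :: "('s, 'e) ts \<Rightarrow> ('r, 'e) ts \<Rightarrow> bool" where
  "ts_isomorphic A B \<longleftrightarrow> events A = events B \<and>
     (\<exists>\<phi>. bij_betw \<phi> (states A) (states B) \<and> \<phi> (init A) = init B \<and>
        (\<forall>s \<in> states A. \<forall>e \<in> events A. \<forall>s' \<in> states A.
           delta A s e = Some s' \<longleftrightarrow> delta B (\<phi> s) e = Some (\<phi> s')))"


section \<open>Boolean nets\<close>

datatype interaction = Nop | Inp | Out | Set | Res | Swap | Used | Free

text \<open>The partial function on \<open>{0, 1}\<close> denoted by an interaction (\<open>False\<close> is 0). Distinct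
  interactions denote distinct partial functions.\<close>

fun interact :: "interaction \<Rightarrow> bool \<Rightarrow> bool option" where
  "interact Nop b = Some b"
| "interact Inp b = (if b then Some False else None)"
| "interact Out b = (if b then None else Some True)"
| "interact Set b = Some True"
| "interact Res b = Some False"
| "interact Swap b = Some (\<not> b)"
| "interact Used b = (if b then Some True else None)"
| "interact Free b = (if b then None else Some False)"

record ('p, 't) net =
  places :: "'p set"
  transitions :: "'t set"
  marking0 :: "'p \<Rightarrow> bool"
  flow :: "'p \<Rightarrow> 't \<Rightarrow> interaction"

text \<open>A marking is a function on the places only; it is represented by the extensional function
  that is \<open>undefined\<close> elsewhere, so that equality of markings is equality on the places.\<close>

definition tau_net :: "interaction set \<Rightarrow> ('p, 't) net \<Rightarrow> bool" where
  "tau_net \<tau> N \<longleftrightarrow>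
     finite (places N) \<and> finite (transitions N) \<and>
     marking0 N \<in> places N \<rightarrow>\<^sub>E UNIV \<and>
     (\<forall>p \<in> places N. \<forall>t \<in> transitions N. flow N p t \<in> \<tau>)"

definition fire :: "('p, 't) net \<Rightarrow> ('p \<Rightarrow> bool) \<Rightarrow> 't \<Rightarrow> ('p \<Rightarrow> bool) option" where
  "fire N M t =
     (if t \<in> transitions N \<and> (\<forall>p \<in> places N. interact (flow N p t) (M p) \<noteq> None)
      then Some (\<lambda>p \<in> places N. the (interact (flow N p t) (M p)))
      else None)"

definition reachability_graph :: "('p, 't) net \<Rightarrow> ('p \<Rightarrow> bool, 't) ts" where
  "reachability_graph N =
     \<lparr> states = reach (fire N) (marking0 N),
       events = transitions N,
       delta = (\<lambda>M t. if M \<in> reach (fire N) (marking0 N) then fire N M t else None),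
       init = marking0 N \<rparr>"

text \<open>Nets have finitely many places, so taking natural numbers as places is no restriction.\<close>

definition tau_solvable :: "interaction set \<Rightarrow> ('s, 'e) ts \<Rightarrow> bool" where
  "tau_solvable \<tau> A \<longleftrightarrow>
     (\<exists>N :: (nat, 'e) net. tau_net \<tau> N \<and> ts_isomorphic A (reachability_graph N))"


section \<open>Polynomial time\<close>

text \<open>The machine model is the random access machine of Cook and Reckhow (Time bounded random
  access machines, JCSS 7, 1973), over the natural numbers and with the uniform cost criterion.
  As addition and truncated subtraction are the only arithmetic operations, \<open>t\<close> steps increase
  the length of the numbers by at most a constant plus \<open>t\<close> bits; hence this model and Turing
  machines simulate each other with polynomial overhead.

  The registers are \<open>X 0, X 1, \<dots>\<close>, all initially 0. The input is a list of numbers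
  consumed by \<open>Read\<close>, which yields 0 when the input is exhausted.\<close>

datatype instr =
    Const nat nat        \<comment> \<open>\<open>X i := c\<close>\<close>
  | Add nat nat nat      \<comment> \<open>\<open>X i := X j + X k\<close>\<close>
  | Sub nat nat nat      \<comment> \<open>\<open>X i := X j - X k\<close> (truncated)\<close>
  | Load nat nat         \<comment> \<open>\<open>X i := X (X j)\<close>\<close>
  | Store nat nat        \<comment> \<open>\<open>X (X i) := X j\<close>\<close>
  | JumpPos nat nat      \<comment> \<open>if \<open>X j > 0\<close> continue with instruction \<open>m\<close>\<close>
  | Read nat             \<comment> \<open>\<open>X i :=\<close> next input number\<close>

text \<open>A configuration: program counter, registers, remaining input.\<close>

type_synonym config = "nat \<times> (nat \<Rightarrow> nat) \<times> nat list"

fun exec :: "instr \<Rightarrow> config \<Rightarrow> config" where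
  "exec (Const i c) (pc, X, w) = (Suc pc, X(i := c), w)"
| "exec (Add i j k) (pc, X, w) = (Suc pc, X(i := X j + X k), w)"
| "exec (Sub i j k) (pc, X, w) = (Suc pc, X(i := X j - X k), w)"
| "exec (Load i j) (pc, X, w) = (Suc pc, X(i := X (X j)), w)"
| "exec (Store i j) (pc, X, w) = (Suc pc, X(X i := X j), w)"
| "exec (JumpPos j m) (pc, X, w) = (if X j > 0 then m else Suc pc, X, w)"
| "exec (Read i) (pc, X, w) = (Suc pc, X(i := (case w of [] \<Rightarrow> 0 | x # _ \<Rightarrow> x)), tl w)"

text \<open>The machine halts when the program counter leaves the program.\<close>

definition halted :: "instr list \<Rightarrow> config \<Rightarrow> bool" where
  "halted P c \<longleftrightarrow> length P \<le> fst c"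

definition step :: "instr list \<Rightarrow> config \<Rightarrow> config" where
  "step P c = (if halted P c then c else exec (P ! fst c) c)"

definition run :: "instr list \<Rightarrow> nat list \<Rightarrow> nat \<Rightarrow> config" where
  "run P w t = (step P ^^ t) (0, (\<lambda>_. 0), w)"

text \<open>A halted machine accepts if register 0 is nonzero.\<close>

definition accepting :: "config \<Rightarrow> bool" where
  "accepting c \<longleftrightarrow> fst (snd c) 0 \<noteq> 0"

text \<open>The size of an input is its length in binary, with one separator per number.\<close>

definition input_size :: "nat list \<Rightarrow> nat" where
  "input_size w = (\<Sum>x \<leftarrow> w. floorlog 2 x + 1)"

text \<open>\<open>I\<close> is the set of instances, \<open>Q\<close> the question, and \<open>enc x w\<close> means that the word \<open>w\<close> is an
  encoding of \<open>x\<close>. An instance may have several encodings (e.g. because a finite set can be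
  listed in different orders); a single program has to answer correctly on all of them.\<close>

definition poly_time_decidable ::
    "('a \<Rightarrow> nat list \<Rightarrow> bool) \<Rightarrow> 'a set \<Rightarrow> ('a \<Rightarrow> bool) \<Rightarrow> bool" where
  "poly_time_decidable enc I Q \<longleftrightarrow>
     (\<exists>(P :: instr list) (p :: nat poly). \<forall>x \<in> I. \<forall>w. enc x w \<longrightarrow>
        (let c = run P w (poly p (input_size w))
         in halted P c \<and> (accepting c \<longleftrightarrow> Q x)))"

text \<open>A transition system is presented by lists of its states, events and arcs, without
  repetitions, preceded by the lengths of these lists and the initial state.\<close>

definition ts_encoding :: "(nat, nat) ts \<Rightarrow> nat list \<Rightarrow> bool" where
  "ts_encoding A w \<longleftrightarrow> (\<exists>ss es as.
     distinct ss \<and> set ss = states A \<and>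
     distinct es \<and> set es = events A \<and>
     distinct as \<and> set as = arcs A \<and>
     w = [length ss, length es, length as, init A] @ ss @ es @
         concat (map (\<lambda>(s, e, s'). [s, e, s']) as))"

end

(*
A reachable 1-bounded transition system is a path or a cycle, and a path can be closed to a cycle by
a fictitious arc; so the system is given by a cyclic word W, and solvability means that regions
separate any two states (SSP) and inhibit every event wherever it is disabled (ESSP).

Granted ESSP, SSP only fails if W is a proper power of a shorter word. For ESSP of an event a in
state j, look back to the last letter x = W i before j that puts 0 into the place. The letters Y
between i and j must preserve 0, and making them nop and all other letters set yields the largest
support. Such a region exists iff no factor z Y* d occurs in W, where z ranges over the letters
producing 0 and d over the letters requiring 1. The interactions out and free are covered by
complementing the support.

The resulting criterion is a first-order formula with quantifiers bounded by 2m over the structure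
(W, <, +), m the number of states. Each quantifier is compiled to a loop of a random access machine,
so a fixed formula is decided in polynomial time once the word W has been extracted from the input.
*)
theory Submission
  imports Defs
begin

section \<open>Regions of cyclic words\<close>

text \<open>Searching for a region directly is exponential in the number of events. The criterion
  needs only a position i and the choice between \<open>Inp\<close> and \<open>Used\<close>, which
  fix the whole signature. Cyclic words are \<open>m\<close>-periodic functions on the naturals, so
  that a factor of the cycle is an ordinary interval. The bound 2m comes from the forbidden factors
  z Y* d: as z is not in Y, it cannot recur before d, so the factor spans at most one period and
  some copy of it starts in the first period. The position j is taken from the second period, so
  that a full period precedes it and the letter that emptied the place is found at some i < j. Each
  type contains an interaction taking 0 to 1, one taking 1 to 0 and one that is undefined somewhere.
  The first two let the fictitious arc join any two values; the third inhibits events that label no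
  arc.\<close>

definition word_region :: "interaction set \<Rightarrow> (nat \<Rightarrow> nat) \<Rightarrow> nat \<Rightarrow> (nat \<Rightarrow> bool) \<Rightarrow> (nat \<Rightarrow> interaction) \<Rightarrow> bool"
  where "word_region \<tau> W m b sig \<longleftrightarrow>
    (\<forall>k. b (k + m) = b k) \<and> range sig \<subseteq> \<tau> \<and>
    (\<forall>k. interact (sig (W k)) (b k) = Some (b (Suc k)))"

definition word_inhibits :: "interaction set \<Rightarrow> (nat \<Rightarrow> nat) \<Rightarrow> nat \<Rightarrow> nat \<Rightarrow> nat \<Rightarrow> bool" where
  "word_inhibits \<tau> W m j a \<longleftrightarrow>
    (\<exists>b sig. word_region \<tau> W m b sig \<and> interact (sig a) (b j) = None)"

definition between :: "(nat \<Rightarrow> nat) \<Rightarrow> nat \<Rightarrow> nat \<Rightarrow> nat set" where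
  "between W i j = {W t |t. i < t \<and> t < j}"

definition factor_free :: "(nat \<Rightarrow> nat) \<Rightarrow> nat \<Rightarrow> nat set \<Rightarrow> nat set \<Rightarrow> nat set \<Rightarrow> bool" where
  "factor_free W n Z Y D \<longleftrightarrow>
    \<not> (\<exists>p q. p < q \<and> q < n \<and> W p \<in> Z \<and> W q \<in> D \<and> between W p q \<subseteq> Y)"

text \<open>The place witnessing that \<open>a\<close> is disabled after \<open>j\<close> letters: \<open>W i\<close> empties it by \<open>Res\<close>
  (by \<open>Inp\<close> if \<open>\<not> R\<close>), the letters between \<open>i\<close> and \<open>j\<close> are \<open>Nop\<close>, all letters not mentioned
  are \<open>Set\<close>, and \<open>a\<close> is \<open>Inp\<close> (first disjunct) or \<open>Used\<close> (second disjunct). The last set in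
  \<^term>\<open>factor_free\<close> consists of the letters that require a token.\<close>

definition inhibitor :: "bool \<Rightarrow> bool \<Rightarrow> bool \<Rightarrow> (nat \<Rightarrow> nat) \<Rightarrow> nat \<Rightarrow> nat \<Rightarrow> nat \<Rightarrow> nat \<Rightarrow> bool" where
  "inhibitor R I U W n i j a \<longleftrightarrow>
     i < j \<and> W i \<notin> between W i j \<and> a \<notin> between W i j \<and>
     (I \<and> factor_free W n {W i, a} (between W i j) (if R then {a} else {W i, a}) \<or>
      U \<and> W i \<noteq> a \<and> factor_free W n {W i} (between W i j) (if R then {a} else {W i, a}))"

lemma periodic_mod:
  fixes f :: "nat \<Rightarrow> 'a"
  assumes "\<And>k. f (k + m) = f k"
  shows "f (k mod m) = f k"
proof -
  have "f (r + q * m) = f r" for r q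
    by (induction q) (use assms in \<open>auto simp: algebra_simps, metis add.assoc add.commute\<close>)
  from this[of "k mod m" "k div m"] show ?thesis by simp
qed

lemma between_Suc: "between W p (Suc q) \<subseteq> Y \<longleftrightarrow> between W p q \<subseteq> Y \<and> (p < q \<longrightarrow> W q \<in> Y)"
  by (auto simp: between_def less_Suc_eq)

section \<open>Complementing the support of a region\<close>

fun dual :: "interaction \<Rightarrow> interaction" where
  "dual Nop = Nop" | "dual Inp = Out" | "dual Out = Inp" | "dual Set = Res" | "dual Res = Set"
| "dual Swap = Swap" | "dual Used = Free" | "dual Free = Used"

lemma interact_dual: "interact (dual a) (\<not> b) = map_option Not (interact a b)"
  by (cases a) auto

lemma word_region_dual:
  assumes "word_region \<tau> W m b sig"
  shows "word_region (dual ` \<tau>) W m (\<lambda>k. \<not> b k) (\<lambda>a. dual (sig a))"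
  using assms by (auto simp: word_region_def interact_dual)

lemma word_inhibits_dual:
  assumes "word_inhibits \<tau> W m j a"
  shows "word_inhibits (dual ` \<tau>) W m j a"
proof -
  obtain b sig where "word_region \<tau> W m b sig" "interact (sig a) (b j) = None"
    using assms by (auto simp: word_inhibits_def)
  then show ?thesis unfolding word_inhibits_def
    by (intro exI[of _ "\<lambda>k. \<not> b k"] exI[of _ "\<lambda>a. dual (sig a)"])
       (simp add: word_region_dual interact_dual)
qed

lemma dual_dual [simp]: "dual (dual a) = a"
  by (cases a) auto

lemma mem_dual: "a \<in> dual ` \<tau> \<longleftrightarrow> dual a \<in> \<tau>"
  by (metis dual_dual imageE imageI)

text \<open>The index \<open>i\<close> is the last one before \<open>j\<close> whose letter can empty the place. Everything after
  it keeps the value 0, and every forbidden factor would propagate a 0 to a letter that needs a 1.\<close>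

lemma inhibitor_if_region:
  assumes reg: "word_region \<tau> W m b sig" and m: "m > 0" "m \<le> j"
    and noswap: "Swap \<notin> \<tau>" and res: "Res \<in> \<tau> \<Longrightarrow> R"
    and sig: "sig (W k) = Inp \<and> I \<or> sig (W k) = Used \<and> U" and bj: "\<not> b j"
  shows "\<exists>i. inhibitor R I U W n i j (W k)"
proof -
  define D where "D = {i. i < j \<and> sig (W i) \<in> {Res, Inp}}"
  have per: "\<And>k. b (k + m) = b k" and step: "\<And>k. interact (sig (W k)) (b k) = Some (b (Suc k))"
    and ran: "\<And>a. sig a \<in> \<tau>"
    using reg by (auto simp: word_region_def)
  \<comment> \<open>Without \<open>Swap\<close>, only \<open>Res\<close> and \<open>Inp\<close> turn
    a 1 into a 0, so the 0 at \<open>j\<close> persists backwards until a position of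
    \<open>D\<close>.\<close>
  have zero_back: "\<not> b t" if "t \<le> j" "\<And>s. t \<le> s \<Longrightarrow> s < j \<Longrightarrow> s \<notin> D" for t
    using that
  proof (induction t rule: inc_induct)
    case base then show ?case using bj by simp
  next
    case (step t)
    then have "sig (W t) \<notin> {Res, Inp}" "\<not> b (Suc t)" "sig (W t) \<noteq> Swap"
      using noswap ran[of "W t"] by (auto simp: D_def)
    then show ?case using \<open>\<And>k. interact (sig (W k)) (b k) = Some (b (Suc k))\<close>[of t]
      by (cases "sig (W t)") (auto split: if_splits)
  qed
  have bk: "b k" using step[of k] sig by (auto split: if_splits)
  \<comment> \<open>Here \<open>m \<le> j\<close> enters: \<open>k mod m\<close> is an occurrence of
    \<open>W k\<close> before \<open>j\<close>, and a 0 traced back that far contradicts the token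
    that \<open>W k\<close> requires.\<close>
  have "D \<noteq> {}"
  proof
    assume "D = {}"
    then have "\<not> b (k mod m)"
      using zero_back[of "k mod m"] m mod_less_divisor[of m k] by fastforce
    then show False using bk periodic_mod[of b m k, OF per] by simp
  qed
  moreover have fin: "finite D" by (auto simp: D_def)
  ultimately have iD: "Max D \<in> D" by simp
  define i where "i = Max D"
  have iD: "i \<in> D" using iD by (simp add: i_def)
  have i: "i < j" "sig (W i) \<in> {Res, Inp}" using iD by (auto simp: D_def)
  have nD: "t \<notin> D" if "i < t" for t using that Max_ge[OF fin, of t] unfolding i_def by linarith
  have b0: "\<not> b t" if "i < t" "t \<le> j" for t using zero_back[of t] that nD by auto
  define Y where "Y = between W i j"
  have Y0: "interact (sig y) False = Some False" if y: "y \<in> Y" for y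
  proof -
    obtain t where t: "y = W t" "i < t" "t < j" using y by (auto simp: Y_def between_def)
    then show ?thesis using step[of t] b0[of t] b0[of "Suc t"] by auto
  qed
  have iY: "W i \<notin> Y" using nD i by (auto simp: Y_def between_def D_def)
  have kY: "W k \<notin> Y" using Y0[of "W k"] sig by auto
  have i0: "interact (sig (W i)) v \<in> {None, Some False}" for v using i by auto
  \<comment> \<open>Proved for any set \<open>Z\<close> of letters that never leave a 1 behind, to
    serve both disjuncts of \<open>inhibitor\<close>: with \<open>W k\<close> in \<open>Z\<close>
    for \<open>Inp\<close>, without it for \<open>Used\<close>.\<close>
  have free: "factor_free W n Z Y (if R then {W k} else {W i, W k})"
    if Z: "\<And>z v. z \<in> Z \<Longrightarrow> interact (sig z) v \<in> {None, Some False}" for Z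
    unfolding factor_free_def
  proof clarify
    fix p q assume pq: "p < q" "W p \<in> Z" "W q \<in> (if R then {W k} else {W i, W k})" "between W p q \<subseteq> Y"
    have "\<not> b q'" if "p < q'" "between W p q' \<subseteq> Y" for q'
      using that
    proof (induction q')
      case (Suc q')
      show ?case
      proof (cases "p < q'")
        case True
        then have "\<not> b q'" "W q' \<in> Y" using Suc by (auto simp: between_Suc)
        then show ?thesis using Y0[of "W q'"] step[of q'] by auto
      next
        case False
        then show ?thesis using Suc.prems Z[OF pq(2), of "b p"] step[of p] by (auto simp: less_Suc_eq)
      qed
    qed simp
    then have "\<not> b q" using pq by blast
    moreover have "\<not> R \<longrightarrow> sig (W i) = Inp" using i ran[of "W i"] res by auto
    ultimately show False using step[of q] sig pq(3) by (auto split: if_splits)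
  qed
  have "inhibitor R I U W n i j (W k)"
  proof (cases "sig (W k) = Inp")
    case True
    then have "factor_free W n {W i, W k} Y (if R then {W k} else {W i, W k})"
      using i0 by (intro free) auto
    then show ?thesis using True sig i iY kY by (auto simp: inhibitor_def Y_def)
  next
    case False
    have "factor_free W n {W i} Y (if R then {W k} else {W i, W k})"
      using i0 by (intro free) auto
    then show ?thesis using False sig i iY kY by (auto simp: inhibitor_def Y_def)
  qed
  then show ?thesis ..
qed

text \<open>Let the zeros be exactly those that letters of \<open>Z\<close> produce and letters of
  \<open>Y\<close> carry on; every other letter leaves a 1. Factor freeness keeps the letters that
  require a token from meeting such a zero. \<open>Z\<close> contains \<open>a\<close> exactly if
  \<open>a\<close> is to be \<open>Inp\<close>, since \<open>Used\<close> leaves the token in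
  place.\<close>

lemma region_if_factor_free:
  assumes W: "\<And>k. W (k + m) = W k" and m: "m > 0" "m \<le> j"
    and ij: "i < j" "W i \<notin> Y" "a \<notin> Y" and Y: "Y = between W i j"
    and Z: "W i \<in> Z" "Z \<subseteq> {W i, a}" "a \<in> Z \<or> mode \<noteq> Inp" "W i = a \<longrightarrow> mode = Inp"
    and D: "D = (if R then {a} else {W i, a})"
    and ff: "factor_free W (2 * m) Z Y D"
    and mode: "mode \<in> {Inp, Used}" "a \<in> Z \<longrightarrow> mode = Inp"
    and \<tau>: "{Nop, Set, mode, if R then Res else Inp} \<subseteq> \<tau>"
  shows "word_inhibits \<tau> W m j a"
proof -
  \<comment> \<open>Looking back from \<open>q + m\<close> instead of \<open>q\<close> provides a
    full period of history even at \<open>q = 0\<close>.\<close>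
  define zero where "zero q \<longleftrightarrow> (\<exists>p < q + m. W p \<in> Z \<and> between W p (q + m) \<subseteq> Y)" for q
  define sig where "sig c = (if c \<in> Y then Nop else if c = a then mode else if c = W i then
     (if R then Res else Inp) else Set)" for c
  have ZY: "Z \<inter> Y = {}" using Z ij by auto
  have zero_Suc: "zero (Suc q) \<longleftrightarrow> W q \<in> Z \<or> W q \<in> Y \<and> zero q" for q
  proof -
    have "zero (Suc q) \<longleftrightarrow> W (q + m) \<in> Z \<or> W (q + m) \<in> Y \<and> zero q"
      unfolding zero_def by (auto simp: between_Suc less_Suc_eq) (auto simp: between_def)
    then show ?thesis by (simp add: W)
  qed
  have zero_per: "zero (q + m) = zero q" for q
  proof
    assume "zero q"
    then obtain p where p: "p < q + m" "W p \<in> Z" "between W p (q + m) \<subseteq> Y" by (auto simp: zero_def)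
    have "between W (p + m) (q + m + m) \<subseteq> Y"
    proof
      fix y assume "y \<in> between W (p + m) (q + m + m)"
      then obtain t where t: "y = W t" "p + m < t" "t < q + m + m" by (auto simp: between_def)
      then have "y = W (t - m)" using W[of "t - m"] by simp
      moreover have "p < t - m" "t - m < q + m" using t by auto
      ultimately show "y \<in> Y" using p by (auto simp: between_def)
    qed
    then show "zero (q + m)" unfolding zero_def using p W by (intro exI[of _ "p + m"]) auto
  next
    assume "zero (q + m)"
    then obtain p where p: "p < q + m + m" "W p \<in> Z" "between W p (q + m + m) \<subseteq> Y"
      by (auto simp: zero_def)
    \<comment> \<open>An earlier start \<open>p\<close> would have its copy \<open>p + m\<close>
      strictly inside the factor, putting a letter of \<open>Z\<close> into
      \<open>Y\<close>.\<close>
    have "p \<ge> q + m"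
    proof (rule ccontr)
      assume "\<not> p \<ge> q + m"
      then have "W (p + m) \<in> between W p (q + m + m)" using m by (auto simp: between_def)
      then show False using p ZY W by auto
    qed
    then have "m \<le> p" by simp
    have "between W (p - m) (q + m) \<subseteq> Y"
    proof
      fix y assume "y \<in> between W (p - m) (q + m)"
      then obtain t where t: "y = W t" "p - m < t" "t < q + m" by (auto simp: between_def)
      then have "y = W (t + m)" "p < t + m" "t + m < q + m + m" using W \<open>m \<le> p\<close> by auto
      then show "y \<in> Y" using p unfolding between_def by blast
    qed
    moreover have "W (p - m) = W p" using W[of "p - m"] \<open>m \<le> p\<close> by simp
    ultimately show "zero q" unfolding zero_def using p \<open>m \<le> p\<close> by (intro exI[of _ "p - m"]) auto
  qed
  \<comment> \<open>Moving \<open>q\<close> into the second period places the whole factor below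
    \<open>2 * m\<close>, where \<open>factor_free\<close> looks.\<close>
  have zero_D: "\<not> zero q" if "W q \<in> D" for q
  proof
    assume "zero q"
    then have "zero (q mod m)" using periodic_mod[of zero m, OF zero_per] by simp
    then obtain p where p: "p < q mod m + m" "W p \<in> Z" "between W p (q mod m + m) \<subseteq> Y"
      by (auto simp: zero_def)
    moreover have "W (q mod m + m) \<in> D" using that W periodic_mod[of W m q] by auto
    moreover have "q mod m + m < 2 * m" using m mod_less_divisor[of m q] by linarith
    ultimately show False using ff unfolding factor_free_def by blast
  qed
  have "interact (sig (W q)) (\<not> zero q) = Some (\<not> zero (Suc q))" for q
    using zero_D[of q] Z ij mode ZY unfolding zero_Suc sig_def D by auto
  moreover have "range sig \<subseteq> \<tau>" using \<tau> by (auto simp: sig_def)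
  ultimately have "word_region \<tau> W m (\<lambda>k. \<not> zero k) sig"
    using zero_per by (auto simp: word_region_def)
  \<comment> \<open>The witness is \<open>i\<close>, since \<open>Y\<close> is
    \<open>between W i j\<close> and \<open>j - m + m = j\<close>.\<close>
  moreover have "zero (j - m)" using ij Z Y m by (auto simp: zero_def)
  then have "zero j" using zero_per[of "j - m"] m by simp
  moreover have "sig a = mode" using ij by (simp add: sig_def)
  ultimately show ?thesis unfolding word_inhibits_def using mode by fastforce
qed

lemma inhibits_if_inhibitor:
  assumes "\<And>k. W (k + m) = W k" "m > 0" "m \<le> j" "inhibitor R I U W (2 * m) i j a"
    and "{Nop, Set, if R then Res else Inp} \<subseteq> \<tau>" and "I \<Longrightarrow> Inp \<in> \<tau>" and "U \<Longrightarrow> Used \<in> \<tau>"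
  shows "word_inhibits \<tau> W m j a"
proof -
  let ?Y = "between W i j" and ?D = "if R then {a} else {W i, a}"
  have ij: "i < j" "W i \<notin> ?Y" "a \<notin> ?Y"
    and "I \<and> factor_free W (2 * m) {W i, a} ?Y ?D \<or> U \<and> W i \<noteq> a \<and> factor_free W (2 * m) {W i} ?Y ?D"
    using assms(4) unfolding inhibitor_def by simp_all
  then consider "I" "factor_free W (2 * m) {W i, a} ?Y ?D"
    | "U" "W i \<noteq> a" "factor_free W (2 * m) {W i} ?Y ?D"
    by blast
  then show ?thesis
  proof cases
    case 1
    then have "{Nop, Set, Inp, if R then Res else Inp} \<subseteq> \<tau>" using assms(5,6) by simp
    from region_if_factor_free[of W m j i ?Y a "{W i, a}" Inp ?D R \<tau>, OF assms(1-3) ij refl _ _ _ _ refl 1(2) _ _ this]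
    show ?thesis by simp
  next
    case 2
    then have "{Nop, Set, Used, if R then Res else Inp} \<subseteq> \<tau>" using assms(5,7) by simp
    from region_if_factor_free[of W m j i ?Y a "{W i}" Used ?D R \<tau>, OF assms(1-3) ij refl _ _ _ _ refl 2(3) _ _ this]
    show ?thesis using 2 by simp
  qed
qed

text \<open>The flags are all that the formula built later knows of the type: whether the 0 may be
  produced by \<open>Res\<close>, and whether the inhibited event may be \<open>Inp\<close> or
  \<open>Used\<close>, up to complement.\<close>

definition inhibition_flags :: "interaction set \<Rightarrow> bool \<Rightarrow> bool \<Rightarrow> bool \<Rightarrow> bool" where
  "inhibition_flags \<tau> R I U \<longleftrightarrow> (\<forall>W m j k. (\<forall>k. W (k + m) = W k) \<longrightarrow> 0 < m \<longrightarrow> m \<le> j \<longrightarrow>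
     (word_inhibits \<tau> W m j (W k) \<longleftrightarrow> (\<exists>i. inhibitor R I U W (2 * m) i j (W k))))"

text \<open>Both partial interactions of these types are undefined at 0 only, so the inhibiting
  place is empty at \<open>j\<close>. Only \<open>Inp\<close> can empty it, hence the flag
  \<open>False\<close>.\<close>

lemma inhibition_flags_no_res:
  assumes "{Nop, Inp, Set} \<subseteq> \<tau>" "\<tau> \<subseteq> {Nop, Inp, Set, Used}"
  shows "inhibition_flags \<tau> False True (Used \<in> \<tau>)"
  unfolding inhibition_flags_def
proof (intro allI impI iffI)
  fix W :: "nat \<Rightarrow> nat" and m j k :: nat
  assume W: "\<forall>k. W (k + m) = W k" and m: "0 < m" "m \<le> j"
  {
    assume "word_inhibits \<tau> W m j (W k)"
    then obtain b sig where reg: "word_region \<tau> W m b sig" and none: "interact (sig (W k)) (b j) = None"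
      by (auto simp: word_inhibits_def)
    have "sig (W k) \<in> \<tau>" using reg by (auto simp: word_region_def)
    then have "sig (W k) = Inp \<and> True \<or> sig (W k) = Used \<and> Used \<in> \<tau>" "\<not> b j"
      using none assms by (cases "sig (W k)"; auto split: if_splits)+
    then show "\<exists>i. inhibitor False True (Used \<in> \<tau>) W (2 * m) i j (W k)"
      using assms by (intro inhibitor_if_region[OF reg m]) auto
  }
  {
    assume "\<exists>i. inhibitor False True (Used \<in> \<tau>) W (2 * m) i j (W k)"
    then obtain i where "inhibitor False True (Used \<in> \<tau>) W (2 * m) i j (W k)" ..
    from inhibits_if_inhibitor[OF _ m this] show "word_inhibits \<tau> W m j (W k)" using W assms by auto
  }
qed

lemma word_inhibits_dual_iff:
  "word_inhibits (dual ` \<tau>) W m j a \<longleftrightarrow> word_inhibits \<tau> W m j a"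
  using word_inhibits_dual[of \<tau> W m j a] word_inhibits_dual[of "dual ` \<tau>" W m j a]
  by (auto simp: image_image)

text \<open>The criterion refers to the type only through the flags, and complementing supports does
  not change which events can be inhibited. Thus the types with \<open>Out\<close> and
  \<open>Res\<close> inherit the flags of those with \<open>Inp\<close> and
  \<open>Set\<close>.\<close>

lemma inhibition_flags_dual:
  "inhibition_flags (dual ` \<tau>) R I U \<longleftrightarrow> inhibition_flags \<tau> R I U"
  by (simp add: inhibition_flags_def word_inhibits_dual_iff)

text \<open>\<open>{Nop, Set, Res}\<close> is closed under complement, so \<open>Inp\<close> and
  \<open>Out\<close> are interchangeable as witnesses, and so are \<open>Used\<close> and
  \<open>Free\<close>.\<close>

lemma inhibition_flags_res:
  assumes "\<tau> = {Nop, Set, Res} \<union> \<omega>" "\<omega> \<subseteq> {Inp, Out, Used, Free}"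
  shows "inhibition_flags \<tau> True (Inp \<in> \<omega> \<or> Out \<in> \<omega>) (Used \<in> \<omega> \<or> Free \<in> \<omega>)" (is "inhibition_flags _ _ ?I ?U")
  unfolding inhibition_flags_def
proof (intro allI impI iffI)
  fix W :: "nat \<Rightarrow> nat" and m j k :: nat
  assume W: "\<forall>k. W (k + m) = W k" and m: "0 < m" "m \<le> j"
  {
    assume "word_inhibits \<tau> W m j (W k)"
    then obtain b sig where reg: "word_region \<tau> W m b sig" and none: "interact (sig (W k)) (b j) = None"
      by (auto simp: word_inhibits_def)
    have "sig (W k) \<in> \<tau>" using reg by (auto simp: word_region_def)
    then consider "sig (W k) = Inp \<and> ?I \<or> sig (W k) = Used \<and> ?U" "\<not> b j"
      | "dual (sig (W k)) = Inp \<and> ?I \<or> dual (sig (W k)) = Used \<and> ?U" "\<not> \<not> b j"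
      using none assms by (cases "sig (W k)"; auto split: if_splits)
    then show "\<exists>i. inhibitor True ?I ?U W (2 * m) i j (W k)"
    proof cases
      case 1
      then show ?thesis using assms by (intro inhibitor_if_region[OF reg m]) auto
    next
      case 2
      then show ?thesis using assms
        by (intro inhibitor_if_region[OF word_region_dual[OF reg] m]) auto
    qed
  }
  {
    assume "\<exists>i. inhibitor True ?I ?U W (2 * m) i j (W k)"
    then obtain i where "inhibitor True ?I ?U W (2 * m) i j (W k)" ..
    \<comment> \<open>An inhibitor uses one disjunct, hence one of the two flags, and the
      interaction behind that flag lies in \<open>\<tau>\<close> or in its dual. A mixture such as
      \<open>Inp\<close> with \<open>Free\<close> therefore causes no conflict.\<close>
    then consider "inhibitor True (Inp \<in> \<tau>) (Used \<in> \<tau>) W (2 * m) i j (W k)"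
      | "inhibitor True (Inp \<in> dual ` \<tau>) (Used \<in> dual ` \<tau>) W (2 * m) i j (W k)"
      unfolding inhibitor_def mem_dual assms(1) by auto
    then show "word_inhibits \<tau> W m j (W k)"
    proof cases
      case 1
      from inhibits_if_inhibitor[OF _ m this, of \<tau>] show ?thesis using W assms by auto
    next
      case 2
      have "{dual Nop, dual Res, dual Set} \<subseteq> dual ` \<tau>" using assms(1) unfolding mem_dual by simp
      then have "word_inhibits (dual ` \<tau>) W m j (W k)"
        using W by (intro inhibits_if_inhibitor[OF _ m 2]) simp_all
      then show ?thesis by (simp only: word_inhibits_dual_iff)
    qed
  }
qed

section \<open>State separation and primitive words\<close>

definition word_separates :: "interaction set \<Rightarrow> (nat \<Rightarrow> nat) \<Rightarrow> nat \<Rightarrow> nat \<Rightarrow> nat \<Rightarrow> bool" where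
  "word_separates \<tau> W m p q \<longleftrightarrow> (\<exists>b sig. word_region \<tau> W m b sig \<and> b p \<noteq> b q)"

text \<open>Invariance under a shift by \<open>d\<close> gives an \<open>m\<close>-periodic word the
  period gcd of \<open>d\<close> and \<open>m\<close>, so this says that the cycle is not a proper
  power. Testing all \<open>d\<close> avoids divisibility in the formula.\<close>

definition primitive_word :: "(nat \<Rightarrow> nat) \<Rightarrow> nat \<Rightarrow> bool" where
  "primitive_word W m \<longleftrightarrow> (\<forall>d. 0 < d \<and> d < m \<longrightarrow> (\<exists>k<m. W (k + d) \<noteq> W k))"

text \<open>Without \<open>Swap\<close>, an event leading from different values to different values acts as \<open>Nop\<close>;
  so on a periodic word a region separating two states one period apart would be constant.\<close>

lemma primitive_if_separates:
  assumes noswap: "Swap \<notin> \<tau>"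
    and sep: "\<And>q. 0 < q \<Longrightarrow> q < m \<Longrightarrow> word_separates \<tau> W m 0 q"
  shows "primitive_word W m"
  unfolding primitive_word_def
proof (intro allI impI, rule ccontr, elim conjE)
  fix d assume d: "0 < d" "d < m" "\<not> (\<exists>k<m. W (k + d) \<noteq> W k)"
  obtain b sig where reg: "word_region \<tau> W m b sig" and b: "b 0 \<noteq> b d" using sep[of d] d by (auto simp: word_separates_def)
  have per: "\<And>k. b (k + m) = b k" and step: "\<And>k. interact (sig (W k)) (b k) = Some (b (Suc k))"
    and ran: "\<And>a. sig a \<in> \<tau>"
    using reg by (auto simp: word_region_def)
  have nop: "b k \<noteq> b (k + d) \<and> sig (W k) = Nop"
    if "k < m" "b (Suc k) \<noteq> b (Suc k + d)" for k
  proof -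
    have "W (k + d) = W k" using d that by auto
    then have "interact (sig (W k)) (b (k + d)) = Some (b (Suc k + d))" using step[of "k + d"] by simp
    then show ?thesis using step[of k] that noswap ran[of "W k"]
      by (cases "sig (W k)") (auto split: if_splits)
  qed
  \<comment> \<open>The induction runs backwards because \<open>nop\<close> infers a difference from
    the one after it. It starts at \<open>m\<close>, where periodicity returns
    \<open>b 0 \<noteq> b d\<close>.\<close>
  have diff: "b k \<noteq> b (k + d)" if "k \<le> m" for k
    using that
  proof (induction k rule: inc_induct)
    case base
    then show ?case using b per[of 0] per[of d] by (simp add: add.commute)
  next
    case (step k) then show ?case using nop[of k] by blast
  qed
  have "b k = b 0" if "k \<le> m" for k
    using that
  proof (induction k)
    case (Suc k)
    then show ?case using nop[of k] diff[of "Suc k"] step[of k] by auto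
  qed simp
  from this[of d] show False using b d by simp
qed

text \<open>States that no region separates behave alike: inhibition forces the same letter at both,
  and since interactions are functions, equality of values passes to the successors. So
  \<open>W\<close> would be invariant under the shift by \<open>q - p\<close>.\<close>

lemma separates_if_primitive:
  assumes W: "\<And>k. W (k + m) = W k" and m: "m > 0" and prim: "primitive_word W m"
    and ess: "\<And>j k. W k \<noteq> 0 \<Longrightarrow> W j \<noteq> W k \<Longrightarrow> word_inhibits \<tau> W m j (W k)"
    and pq: "p < q" "q < m"
  shows "word_separates \<tau> W m p q"
proof (rule ccontr)
  assume "\<not> ?thesis"
  then have eq: "b p = b q" if "word_region \<tau> W m b sig" for b sig
    using that by (auto simp: word_separates_def)
  define d where "d = q - p"
  have W_eq: "W k = W (k + d)" if "\<And>b sig. word_region \<tau> W m b sig \<Longrightarrow> b k = b (k + d)" for k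
  proof (rule ccontr)
    have no: False if Wk': "W k' \<noteq> 0" "W j \<noteq> W k'"
      and eq': "\<And>b sig. word_region \<tau> W m b sig \<Longrightarrow> b j = b k'" for j k'
    proof -
      obtain b sig where reg: "word_region \<tau> W m b sig" "interact (sig (W k')) (b j) = None"
        using ess[OF Wk'] by (auto simp: word_inhibits_def)
      then show False using reg eq'[OF reg(1)] by (auto simp: word_region_def)
    qed
    assume "W k \<noteq> W (k + d)"
    \<comment> \<open>Two different letters are not both 0, so one of them is an event that can be
      inhibited at the position of the other.\<close>
    then consider "W k \<noteq> 0" "W (k + d) \<noteq> W k" | "W (k + d) \<noteq> 0" "W k \<noteq> W (k + d)"
      by (cases "W k = 0") auto
    then show False
    proof cases
      case 1
      then show False by (rule no) (simp add: that)
    next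
      case 2
      then show False by (rule no) (rule that)
    qed
  qed
  have all: "b (p + i) = b (p + i + d)" if "word_region \<tau> W m b sig" for i b sig
    using that
  proof (induction i arbitrary: b sig)
    case 0 then show ?case using eq pq by (simp add: d_def)
  next
    case (Suc i)
    then have "W (p + i) = W (p + i + d)" by (intro W_eq) blast
    moreover have "interact (sig (W k)) (b k) = Some (b (Suc k))" for k
      using Suc.prems by (simp add: word_region_def)
    from this[of "p + i"] this[of "p + i + d"]
    have "interact (sig (W (p + i))) (b (p + i)) = Some (b (Suc (p + i)))"
      "interact (sig (W (p + i + d))) (b (p + i + d)) = Some (b (Suc (p + i + d)))" .
    ultimately show ?case using Suc.IH[OF Suc.prems] by simp
  qed
  have "W k = W (k + d)" for k
  proof -
    \<comment> \<open>Going \<open>p\<close> periods ahead moves any \<open>k\<close> to or beyond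
      \<open>p\<close>, where \<open>all\<close> applies.\<close>
    have "W (p + (k + p * m - p)) = W (p + (k + p * m - p) + d)" by (intro W_eq all)
    moreover have "p + (k + p * m - p) = k + p * m" using m by (cases m) auto
    ultimately have *: "W (k + p * m) = W (k + d + p * m)" by (simp add: algebra_simps)
    have "W (r + p * m) = W r" for r
      using periodic_mod[of W m "r + p * m", OF W] periodic_mod[of W m r, OF W] by simp
    then show ?thesis using * by simp
  qed
  then have "\<not> (\<exists>k<m. W (k + d) \<noteq> W k)" by simp
  moreover have "0 < d" "d < m" using pq by (auto simp: d_def)
  ultimately show False using prim unfolding primitive_word_def by blast
qed

section \<open>Regions and synthesis\<close>

definition region :: "interaction set \<Rightarrow> ('s, 'e) ts \<Rightarrow> ('s \<Rightarrow> bool) \<Rightarrow> ('e \<Rightarrow> interaction) \<Rightarrow> bool" where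
  "region \<tau> A mk sig \<longleftrightarrow> (\<forall>e \<in> events A. sig e \<in> \<tau>) \<and>
     (\<forall>s e s'. delta A s e = Some s' \<longrightarrow> interact (sig e) (mk s) = Some (mk s'))"

definition separable :: "interaction set \<Rightarrow> ('s, 'e) ts \<Rightarrow> 's \<Rightarrow> 's \<Rightarrow> bool" where
  "separable \<tau> A s s' \<longleftrightarrow> (\<exists>mk sig. region \<tau> A mk sig \<and> mk s \<noteq> mk s')"

definition inhibitable :: "interaction set \<Rightarrow> ('s, 'e) ts \<Rightarrow> 's \<Rightarrow> 'e \<Rightarrow> bool" where
  "inhibitable \<tau> A s e \<longleftrightarrow> (\<exists>mk sig. region \<tau> A mk sig \<and> interact (sig e) (mk s) = None)"

lemma transition_systemD:
  assumes "transition_system A" "delta A s e = Some s'"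
  shows "s \<in> states A" "e \<in> events A" "s' \<in> states A"
  using assms by (auto simp: transition_system_def arcs_def)

lemma reach_step: "s \<in> reach d s0 \<Longrightarrow> d s e = Some s' \<Longrightarrow> s' \<in> reach d s0"
  unfolding reach_def by (auto intro: rtrancl_into_rtrancl)

lemma reach_init: "s0 \<in> reach d s0"
  by (simp add: reach_def)

lemma reach_induct [consumes 1, case_names init step]:
  assumes "s \<in> reach d s0" "P s0" "\<And>s e s'. s \<in> reach d s0 \<Longrightarrow> P s \<Longrightarrow> d s e = Some s' \<Longrightarrow> P s'"
  shows "P s"
proof -
  have "(s0, s) \<in> {(u, v). \<exists>e. d u e = Some v}\<^sup>*" using assms(1) by (simp add: reach_def)
  then show ?thesis
    by (induction rule: rtrancl_induct) (use assms(2,3) in \<open>auto simp: reach_def\<close>)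
qed

lemma reach_fire_PiE:
  assumes "tau_net \<tau> N" "M \<in> reach (fire N) (marking0 N)"
  shows "M \<in> places N \<rightarrow>\<^sub>E UNIV"
  using assms(2)
proof (induction rule: reach_induct)
  case init then show ?case using assms by (simp add: tau_net_def)
qed (auto simp: fire_def split: if_splits)

text \<open>A place read along the isomorphism is a region, with its row of \<open>flow\<close> as
  signature. Distinct markings differ in some place, and a disabled transition is blocked by some
  place.\<close>

lemma solvable_imp_regions:
  assumes A: "transition_system A" and sol: "tau_solvable \<tau> A"
  shows "\<And>s s'. s \<in> states A \<Longrightarrow> s' \<in> states A \<Longrightarrow> s \<noteq> s' \<Longrightarrow> separable \<tau> A s s'"
    and "\<And>s e. s \<in> states A \<Longrightarrow> e \<in> events A \<Longrightarrow> delta A s e = None \<Longrightarrow> inhibitable \<tau> A s e"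
proof -
  obtain N :: "(nat, 'b) net" and \<phi> where N: "tau_net \<tau> N"
    and ev: "events A = transitions N"
    and bij: "bij_betw \<phi> (states A) (reach (fire N) (marking0 N))"
    and delta: "\<And>s e s'. s \<in> states A \<Longrightarrow> e \<in> events A \<Longrightarrow> s' \<in> states A \<Longrightarrow>
      delta A s e = Some s' \<longleftrightarrow> delta (reachability_graph N) (\<phi> s) e = Some (\<phi> s')"
    using sol unfolding tau_solvable_def ts_isomorphic_def by (auto simp: reachability_graph_def)
  have reach: "\<phi> s \<in> reach (fire N) (marking0 N)" if "s \<in> states A" for s
    using bij that by (auto simp: bij_betw_def)
  have delta': "delta A s e = Some s' \<longleftrightarrow> fire N (\<phi> s) e = Some (\<phi> s')"
    if "s \<in> states A" "e \<in> events A" "s' \<in> states A" for s e s'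
    using delta[OF that] reach that by (simp add: reachability_graph_def)
  have reg: "region \<tau> A (\<lambda>s. \<phi> s p) (flow N p)" if p: "p \<in> places N" for p
    unfolding region_def
  proof (intro conjI ballI allI impI)
    fix e assume "e \<in> events A" then show "flow N p e \<in> \<tau>" using N p ev by (auto simp: tau_net_def)
  next
    fix s e s' assume d: "delta A s e = Some s'"
    then have "fire N (\<phi> s) e = Some (\<phi> s')" using delta' transition_systemD[OF A] by blast
    then have "interact (flow N p e) (\<phi> s p) \<noteq> None"
      "\<phi> s' = (\<lambda>p \<in> places N. the (interact (flow N p e) (\<phi> s p)))"
      using p by (auto simp: fire_def split: if_splits)
    then show "interact (flow N p e) (\<phi> s p) = Some (\<phi> s' p)" using p by auto
  qed
  {
    fix s s' assume s: "s \<in> states A" "s' \<in> states A" "s \<noteq> s'"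
    then have "\<phi> s \<noteq> \<phi> s'" using bij by (auto simp: bij_betw_def inj_on_def)
    then obtain p where "p \<in> places N" "\<phi> s p \<noteq> \<phi> s' p"
      using PiE_ext[OF reach_fire_PiE[OF N reach[OF s(1)]] reach_fire_PiE[OF N reach[OF s(2)]]] by blast
    then show "separable \<tau> A s s'" unfolding separable_def
      using reg by (intro exI[of _ "\<lambda>s. \<phi> s p"] exI[of _ "flow N p"]) auto
  }
  {
    fix s e assume s: "s \<in> states A" "e \<in> events A" "delta A s e = None"
    have "fire N (\<phi> s) e = None"
    proof (rule ccontr)
      assume "fire N (\<phi> s) e \<noteq> None"
      then obtain M where M: "fire N (\<phi> s) e = Some M" by auto
      then have "M \<in> \<phi> ` states A" using bij reach_step[OF reach[OF s(1)] M] by (auto simp: bij_betw_def)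
      then obtain s' where "s' \<in> states A" "M = \<phi> s'" by auto
      then show False using delta'[of s e s'] s M by auto
    qed
    then obtain p where "p \<in> places N" "interact (flow N p e) (\<phi> s p) = None"
      using s ev by (auto simp: fire_def split: if_splits)
    then show "inhibitable \<tau> A s e" unfolding inhibitable_def
      using reg by (intro exI[of _ "\<lambda>s. \<phi> s p"] exI[of _ "flow N p"]) auto
  }
qed

text \<open>The synthesized net has a place for each chosen witness region. Separation makes the map
  from states to markings injective; inhibition prevents firings that \<open>A\<close>
  lacks.\<close>

lemma regions_imp_solvable:
  assumes A: "transition_system A"
    and sep: "\<And>s s'. s \<in> states A \<Longrightarrow> s' \<in> states A \<Longrightarrow> s \<noteq> s' \<Longrightarrow> separable \<tau> A s s'"
    and inh: "\<And>s e. s \<in> states A \<Longrightarrow> e \<in> events A \<Longrightarrow> delta A s e = None \<Longrightarrow> inhibitable \<tau> A s e"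
  shows "tau_solvable \<tau> A"
proof -
  define f where "f s s' = (SOME r. region \<tau> A (fst r) (snd r) \<and> fst r s \<noteq> fst r s')" for s s'
  have f: "region \<tau> A (fst (f s s')) (snd (f s s')) \<and> fst (f s s') s \<noteq> fst (f s s') s'"
    if "s \<in> states A" "s' \<in> states A" "s \<noteq> s'" for s s'
    unfolding f_def by (rule someI_ex) (use sep[OF that] in \<open>auto simp: separable_def\<close>)
  define g where "g s e = (SOME r. region \<tau> A (fst r) (snd r) \<and> interact (snd r e) (fst r s) = None)" for s e
  have g: "region \<tau> A (fst (g s e)) (snd (g s e)) \<and> interact (snd (g s e) e) (fst (g s e) s) = None"
    if "s \<in> states A" "e \<in> events A" "delta A s e = None" for s e
    unfolding g_def by (rule someI_ex) (use inh[OF that] in \<open>auto simp: inhibitable_def\<close>)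
  define Rs where "Rs = (\<lambda>(s, s'). f s s') ` {(s, s'). s \<in> states A \<and> s' \<in> states A \<and> s \<noteq> s'} \<union>
    (\<lambda>(s, e). g s e) ` {(s, e). s \<in> states A \<and> e \<in> events A \<and> delta A s e = None}"
  have fin: "finite (states A)" "finite (events A)" and init: "init A \<in> states A"
    and rch: "states A \<subseteq> reach (delta A) (init A)"
    using A by (auto simp: transition_system_def)
  have "finite Rs" unfolding Rs_def
    by (intro finite_UnI finite_imageI finite_subset[OF _ finite_cartesian_product[OF fin(1) fin(1)]]
      finite_subset[OF _ finite_cartesian_product[OF fin]]) auto
  \<comment> \<open>Finitely many witnesses can be numbered, as \<open>tau_solvable\<close> takes
    natural numbers as places.\<close>
  then obtain n and r :: "nat \<Rightarrow> _" where r: "Rs = r ` {i. i < n}"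
    by (auto dest!: finite_imp_nat_seg_image_inj_on)
  have reg: "region \<tau> A (fst (r p)) (snd (r p))" if "p < n" for p
  proof -
    have "r p \<in> Rs" using r that by auto
    then show ?thesis using f g unfolding Rs_def by auto
  qed
  define \<phi> where "\<phi> s = (\<lambda>p\<in>{..<n}. fst (r p) s)" for s
  define N where "N = \<lparr>places = {..<n}, transitions = events A, marking0 = \<phi> (init A),
    flow = \<lambda>p. snd (r p)\<rparr>"
  have N: "tau_net \<tau> N" using fin reg by (auto simp: tau_net_def N_def \<phi>_def region_def)
  have fire_Some: "fire N (\<phi> s) e = Some (\<phi> s')" if "delta A s e = Some s'" for s e s'
  proof -
    have "interact (snd (r p) e) (fst (r p) s) = Some (fst (r p) s')" if "p < n" for p
      using reg[OF that] \<open>delta A s e = Some s'\<close> by (simp add: region_def)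
    then show ?thesis using transition_systemD[OF A that]
      by (auto simp: fire_def N_def \<phi>_def fun_eq_iff)
  qed
  have fire_None: "fire N (\<phi> s) e = None" if s: "s \<in> states A" "delta A s e = None" for s e
  proof (cases "e \<in> events A")
    case True
    then have "g s e \<in> Rs" using s unfolding Rs_def by force
    then obtain p where p: "p < n" "r p = g s e" using r by auto
    then have "interact (snd (r p) e) (fst (r p) s) = None" using g[OF s(1) True s(2)] by simp
    then show ?thesis using p(1) by (auto simp: fire_def N_def \<phi>_def)
  qed (simp add: fire_def N_def)
  have inj: "inj_on \<phi> (states A)"
  proof (rule inj_onI, rule ccontr)
    fix s s' assume s: "s \<in> states A" "s' \<in> states A" "\<phi> s = \<phi> s'" "s \<noteq> s'"
    then have "f s s' \<in> Rs" unfolding Rs_def by force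
    then obtain p where p: "p < n" "r p = f s s'" using r by auto
    then have "\<phi> s p \<noteq> \<phi> s' p" using f[OF s(1,2,4)] by (simp add: \<phi>_def)
    then show False using s(3) by simp
  qed
  have "\<phi> s \<in> reach (fire N) (marking0 N)" if "s \<in> reach (delta A) (init A)" for s
    using that
  proof (induction rule: reach_induct)
    case init then show ?case by (simp add: N_def reach_init)
  next
    case (step s e s') then show ?case using fire_Some reach_step by metis
  qed
  moreover have "M \<in> \<phi> ` states A" if "M \<in> reach (fire N) (marking0 N)" for M
    using that
  proof (induction rule: reach_induct)
    case init then show ?case using \<open>init A \<in> states A\<close> by (simp add: N_def)
  next
    case (step M e M')
    then obtain s where s: "s \<in> states A" "M = \<phi> s" by auto
    then obtain s' where "delta A s e = Some s'" using fire_None[of s e] step by (cases "delta A s e") auto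
    then show ?case using fire_Some[of s e s'] s step transition_systemD[OF A] by auto
  qed
  ultimately have img: "\<phi> ` states A = reach (fire N) (marking0 N)" using rch by blast
  have "ts_isomorphic A (reachability_graph N)"
    unfolding ts_isomorphic_def
  proof (intro conjI exI[of _ \<phi>] ballI)
    show "bij_betw \<phi> (states A) (states (reachability_graph N))"
      using inj img by (simp add: bij_betw_def reachability_graph_def)
    fix s e s' assume s: "s \<in> states A" "e \<in> events A" "s' \<in> states A"
    then have "delta (reachability_graph N) (\<phi> s) e = fire N (\<phi> s) e"
      using img by (auto simp: reachability_graph_def)
    moreover have "fire N (\<phi> s) e = map_option \<phi> (delta A s e)"
      using fire_None[OF s(1)] fire_Some[of s e] by (cases "delta A s e") auto
    ultimately show "delta A s e = Some s' \<longleftrightarrow> delta (reachability_graph N) (\<phi> s) e = Some (\<phi> s')"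
      using s inj transition_systemD(3)[OF A] by (auto simp: inj_on_eq_iff)
  qed (simp_all add: reachability_graph_def N_def)
  then show ?thesis using N unfolding tau_solvable_def by blast
qed

section \<open>One-bounded transition systems as cyclic words\<close>

definition next_state :: "('s, nat) ts \<Rightarrow> 's \<Rightarrow> 's" where
  "next_state A s = (if \<exists>e s'. delta A s e = Some s' then SOME s'. \<exists>e. delta A s e = Some s' else init A)"

text \<open>The label 0 marks a missing outgoing arc, which is completed by a fictitious arc to the
  initial state. This arc occurs only once on the resulting cycle and imposes no restriction on
  regions, so that paths and cycles are treated alike.\<close>

definition label :: "('s, nat) ts \<Rightarrow> 's \<Rightarrow> nat" where
  "label A s = (if \<exists>e s'. delta A s e = Some s' then Suc (SOME e. \<exists>s'. delta A s e = Some s') else 0)"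

definition walk :: "('s, nat) ts \<Rightarrow> nat \<Rightarrow> 's" where
  "walk A k = (next_state A ^^ k) (init A)"

definition word :: "('s, nat) ts \<Rightarrow> nat \<Rightarrow> nat" where
  "word A k = label A (walk A k)"

locale one_bounded =
  fixes A :: "('s, nat) ts"
  assumes A: "transition_system A" and bnd: "bounded 1 A"
begin

abbreviation "m \<equiv> card (states A)"

lemma finite_arcs: "finite (arcs A)"
  using A by (auto simp: transition_system_def intro: finite_subset)

lemma out_unique:
  assumes "delta A s e = Some s'" "delta A s f = Some t"
  shows "e = f" "s' = t"
proof -
  have "s \<in> states A" using transition_systemD[OF A assms(1)] by simp
  then have "card {(s', e, s'') \<in> arcs A. s' = s} \<le> 1" using bnd by (simp add: bounded_def)
  moreover have f: "finite {(s', e, s'') \<in> arcs A. s' = s}" by (rule finite_subset[OF _ finite_arcs]) auto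
  moreover have "(s, e, s') \<in> {(s', e, s'') \<in> arcs A. s' = s}" "(s, f, t) \<in> {(s', e, s'') \<in> arcs A. s' = s}"
    using assms by (auto simp: arcs_def)
  ultimately have "(s, e, s') = (s, f, t)" unfolding One_nat_def card_le_Suc0_iff_eq[OF f] by blast
  then show "e = f" "s' = t" by auto
qed

lemma in_unique:
  assumes "delta A s e = Some s'" "delta A t f = Some s'"
  shows "s = t"
proof -
  have "s' \<in> states A" using transition_systemD[OF A assms(1)] by simp
  then have "card {(s, e, s'') \<in> arcs A. s'' = s'} \<le> 1" using bnd by (simp add: bounded_def)
  moreover have f: "finite {(s, e, s'') \<in> arcs A. s'' = s'}" by (rule finite_subset[OF _ finite_arcs]) auto
  moreover have "(s, e, s') \<in> {(s, e, s'') \<in> arcs A. s'' = s'}" "(t, f, s') \<in> {(s, e, s'') \<in> arcs A. s'' = s'}"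
    using assms by (auto simp: arcs_def)
  ultimately have "(s, e, s') = (t, f, s')" unfolding One_nat_def card_le_Suc0_iff_eq[OF f] by blast
  then show "s = t" by auto
qed

lemma arc_iff: "delta A s e = Some s' \<longleftrightarrow> label A s = Suc e \<and> s' = next_state A s"
proof (cases "\<exists>e s'. delta A s e = Some s'")
  case True
  then obtain f t where ft: "delta A s f = Some t" by auto
  have "(SOME e. \<exists>s'. delta A s e = Some s') = f" "(SOME s'. \<exists>e. delta A s e = Some s') = t"
    by (rule some_equality; use ft out_unique in blast)+
  then have "label A s = Suc f" "next_state A s = t"
    using True unfolding label_def next_state_def by auto
  moreover have "delta A s e = Some s' \<longleftrightarrow> e = f \<and> s' = t" using ft out_unique by blast
  ultimately show ?thesis by auto
qed (auto simp: label_def)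

lemma label_0: "label A s = 0 \<Longrightarrow> next_state A s = init A"
  by (auto simp: label_def next_state_def split: if_splits)

lemma init_state: "init A \<in> states A" and fin: "finite (states A)"
  using A by (auto simp: transition_system_def)

lemma next_state: "s \<in> states A \<Longrightarrow> next_state A s \<in> states A"
  using arc_iff[of s "label A s - 1" "next_state A s"] label_0[of s] init_state transition_systemD(3)[OF A]
  by (cases "label A s") auto

lemma walk_in: "walk A k \<in> states A"
  by (induction k) (auto simp: walk_def init_state next_state)

lemma walk_Suc: "walk A (Suc k) = next_state A (walk A k)"
  by (simp add: walk_def)

lemma states_walk: "states A = range (walk A)"
proof -
  have "s \<in> range (walk A)" if "s \<in> reach (delta A) (init A)" for s
    using that
  proof (induction rule: reach_induct)
    case init have "init A = walk A 0" by (simp add: walk_def) then show ?case by blast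
  next
    case (step s e s')
    then obtain k where "s = walk A k" by auto
    then have "s' = walk A (Suc k)" using step arc_iff by (simp add: walk_Suc)
    then show ?case by blast
  qed
  then show ?thesis using walk_in A by (auto simp: transition_system_def)
qed

text \<open>On a finite set, injectivity and surjectivity coincide. Without a fictitious arc,
  in-degree at most one gives injectivity; with one, surjectivity is easy, as that arc supplies a
  predecessor of \<open>init A\<close>.\<close>

lemma bij_next: "bij_betw (next_state A) (states A) (states A)"
proof -
  have "next_state A ` states A = states A"
  proof (cases "\<exists>s \<in> states A. label A s = 0")
    case True
    then have "init A \<in> next_state A ` states A" using label_0 by (metis imageI)
    then have "walk A k \<in> next_state A ` states A" for k
      using walk_in by (cases k) (simp_all add: walk_def)
    then have "range (walk A) \<subseteq> next_state A ` states A" by blast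
    then have "states A \<subseteq> next_state A ` states A" by (simp only: states_walk[symmetric])
    then show ?thesis using next_state by blast
  next
    case False
    have "inj_on (next_state A) (states A)"
    proof (rule inj_onI)
      fix s t assume st: "s \<in> states A" "t \<in> states A" "next_state A s = next_state A t"
      then have "label A s \<noteq> 0" "label A t \<noteq> 0" using False by auto
      then obtain e f where "label A s = Suc e" "label A t = Suc f" using not0_implies_Suc by blast
      then have "delta A s e = Some (next_state A s)" "delta A t f = Some (next_state A s)"
        using st arc_iff by auto
      then show "s = t" by (rule in_unique)
    qed
    then show ?thesis using endo_inj_surj[OF fin] next_state by blast
  qed
  then show ?thesis using eq_card_imp_inj_on[OF fin, of "next_state A"] by (simp add: bij_betw_def)
qed

lemma walk_cancel: "walk A (i + k) = walk A (j + k) \<Longrightarrow> walk A i = walk A j"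
proof (induction k)
  case (Suc k)
  then show ?case using bij_next walk_in by (auto simp: bij_betw_def walk_Suc inj_on_eq_iff)
qed simp

text \<open>Because \<open>next_state\<close> is injective, the walk has no tail before its cycle: a
  repetition implies a return to \<open>init A\<close>. The least return time counts the visited
  states, which are all states.\<close>

lemma walk_period: "walk A (k + m) = walk A k" and walk_inj: "inj_on (walk A) {..<m}"
  and states_eq: "states A = walk A ` {..<m}"
proof -
  have "\<not> inj (walk A)" using fin range_inj_infinite[of "walk A"] unfolding states_walk by blast
  then obtain i j where ij: "i < j" "walk A i = walk A j" using linorder_injI[of "walk A"] by blast
  then have "walk A (0 + i) = walk A ((j - i) + i)" by simp
  then have ex: "0 < j - i \<and> walk A (j - i) = walk A 0" using walk_cancel[of 0 i "j - i"] ij by auto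
  define p where "p = (LEAST p. 0 < p \<and> walk A p = walk A 0)"
  have p: "0 < p" "walk A p = walk A 0" using LeastI[of "\<lambda>p. 0 < p \<and> walk A p = walk A 0", OF ex] by (auto simp: p_def)
  have least: "p \<le> q" if "0 < q" "walk A q = walk A 0" for q unfolding p_def by (rule Least_le) (use that in auto)
  have per: "walk A (k + p) = walk A k" for k
    by (induction k) (use p in \<open>auto simp: walk_Suc\<close>)
  have neq: "walk A i \<noteq> walk A j" if "i < j" "j < p" for i j
  proof
    assume "walk A i = walk A j"
    then have "walk A (j - i) = walk A 0" using walk_cancel[of 0 i "j - i"] that by simp
    then show False using least[of "j - i"] that by auto
  qed
  then have inj: "inj_on (walk A) {..<p}" by (intro linorder_inj_onI) auto
  have "walk A k \<in> walk A ` {..<p}" for k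
    using periodic_mod[of "walk A" p k, OF per, symmetric] p mod_less_divisor[of p k]
    by (intro image_eqI[of _ _ "k mod p"]) auto
  then have img: "states A = walk A ` {..<p}" using states_walk by auto
  have pm: "p = m" using card_image[OF inj] unfolding img by simp
  show "walk A (k + m) = walk A k" "inj_on (walk A) {..<m}" "states A = walk A ` {..<m}"
    by (fact per[unfolded pm] inj[unfolded pm] img[unfolded pm])+
qed

lemma m_pos: "m > 0" using init_state fin card_gt_0_iff by blast

lemma word_period: "word A (k + m) = word A k" by (simp add: word_def walk_period)

lemma walk_arc_iff: "delta A (walk A k) e = Some s' \<longleftrightarrow> word A k = Suc e \<and> s' = walk A (Suc k)"
  by (simp add: arc_iff word_def walk_Suc)

lemma walk_mod: "walk A (k mod m) = walk A k"
  by (rule periodic_mod) (rule walk_period)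

lemma walk_eq_iff: "walk A i = walk A j \<longleftrightarrow> i mod m = j mod m"
proof -
  have "walk A (i mod m) = walk A (j mod m) \<longleftrightarrow> i mod m = j mod m"
    using m_pos by (intro inj_on_eq_iff[OF walk_inj]) simp_all
  then show ?thesis by (simp only: walk_mod)
qed

lemma word_0_unique:
  assumes "word A i = 0" "word A j = 0"
  shows "walk A i = walk A j"
proof -
  have "next_state A (walk A i) = next_state A (walk A j)"
    using assms label_0 by (simp add: word_def)
  then show ?thesis using bij_next walk_in by (auto simp: bij_betw_def inj_on_eq_iff)
qed

text \<open>Only the fictitious letter needs a new interaction. It labels a single arc of the cycle,
  so an interaction joining the values at its two ends suffices, and \<open>Nop\<close>,
  \<open>u\<close> and \<open>d\<close> cover all combinations.\<close>

lemma word_region_of_region: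
  assumes reg: "region \<tau> A mk sig" and nop: "Nop \<in> \<tau>"
    and up: "u \<in> \<tau>" "interact u False = Some True" and down: "d \<in> \<tau>" "interact d True = Some False"
  obtains sig' where "word_region \<tau> (word A) m (\<lambda>k. mk (walk A k)) sig'"
    and "\<And>e. e \<in> events A \<Longrightarrow> sig' (Suc e) = sig e"
proof -
  \<comment> \<open>If the letter 0 does not occur, \<open>z\<close> is arbitrary; \<open>i0\<close>
    still lies in \<open>\<tau>\<close>, as \<open>word_region\<close> demands.\<close>
  define z where "z = (SOME k. word A k = 0)"
  define i0 where "i0 = (if mk (walk A z) = mk (init A) then Nop else if mk (walk A z) then d else u)"
  define sig' where "sig' a = (case a of 0 \<Rightarrow> i0 | Suc e \<Rightarrow> if e \<in> events A then sig e else Nop)" for a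
  have i0: "interact i0 (mk (walk A z)) = Some (mk (init A))" "i0 \<in> \<tau>"
    using up down nop by (auto simp: i0_def)
  have "interact (sig' (word A k)) (mk (walk A k)) = Some (mk (walk A (Suc k)))" for k
  proof (cases "word A k")
    case 0
    then have "word A z = 0" unfolding z_def by (rule someI)
    then have "walk A k = walk A z" using 0 by (intro word_0_unique)
    moreover have "walk A (Suc k) = init A" using 0 label_0 by (simp add: word_def walk_Suc)
    ultimately show ?thesis using 0 i0 by (simp add: sig'_def)
  next
    case (Suc e)
    then have "delta A (walk A k) e = Some (walk A (Suc k))" by (simp add: walk_arc_iff)
    then show ?thesis using reg Suc transition_systemD(2)[OF A] by (auto simp: sig'_def region_def)
  qed
  moreover have "range sig' \<subseteq> \<tau>" using i0 nop reg
    by (auto simp: sig'_def region_def split: nat.split)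
  ultimately have "word_region \<tau> (word A) m (\<lambda>k. mk (walk A k)) sig'"
    by (simp add: word_region_def walk_period)
  then show thesis by (rule that) (simp add: sig'_def)
qed

lemma region_of_word_region:
  assumes reg: "word_region \<tau> (word A) m b sig'"
  obtains mk where "region \<tau> A mk (\<lambda>e. sig' (Suc e))" and "\<forall>k. mk (walk A k) = b k"
proof -
  define mk where "mk s = (\<exists>k. s = walk A k \<and> b k)" for s
  have per: "b (k mod m) = b k" for k using reg by (intro periodic_mod) (simp add: word_region_def)
  have mk: "mk (walk A k) = b k" for k
  proof -
    have "b i = b k" if "i mod m = k mod m" for i using per[of i] per[of k] that by simp
    then show ?thesis unfolding mk_def walk_eq_iff by metis
  qed
  have "region \<tau> A mk (\<lambda>e. sig' (Suc e))" unfolding region_def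
  proof (intro conjI ballI allI impI)
    fix s e s' assume d: "delta A s e = Some s'"
    then obtain k where k: "s = walk A k" using transition_systemD(1)[OF A] states_walk by blast
    then have "word A k = Suc e" "s' = walk A (Suc k)" using d walk_arc_iff by auto
    moreover have "interact (sig' (word A k)) (b k) = Some (b (Suc k))"
      using reg by (simp add: word_region_def)
    ultimately show "interact (sig' (Suc e)) (mk s) = Some (mk s')"
      by (simp add: k mk)
  qed (use reg in \<open>auto simp: word_region_def\<close>)
  then show thesis by (rule that) (use mk in blast)
qed

text \<open>\<open>u\<close> and \<open>d\<close> serve the fictitious arc, \<open>c\<close> the
  events that label no arc. Positions are restricted to the range of the quantifiers of the formula,
  with \<open>j\<close> in the second period.\<close>

lemma solvable_iff_word:
  assumes nop: "Nop \<in> \<tau>"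
    and up: "u \<in> \<tau>" "interact u False = Some True" and down: "d \<in> \<tau>" "interact d True = Some False"
    and noswap: "Swap \<notin> \<tau>" and inh: "c \<in> \<tau>" "interact c v = None"
  shows "tau_solvable \<tau> A \<longleftrightarrow> primitive_word (word A) m \<and>
    (\<forall>j k. m \<le> j \<and> j < 2 * m \<and> k < 2 * m \<and> word A k \<noteq> 0 \<and> word A j \<noteq> word A k \<longrightarrow>
       word_inhibits \<tau> (word A) m j (word A k))" (is "_ \<longleftrightarrow> ?prim \<and> ?ess")
proof -
  have sep_iff: "separable \<tau> A (walk A p) (walk A q) \<longleftrightarrow> word_separates \<tau> (word A) m p q" for p q
  proof
    assume "separable \<tau> A (walk A p) (walk A q)"
    then obtain mk sig where reg: "region \<tau> A mk sig" and neq: "mk (walk A p) \<noteq> mk (walk A q)"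
      by (auto simp: separable_def)
    obtain sig' where "word_region \<tau> (word A) m (\<lambda>k. mk (walk A k)) sig'"
      using word_region_of_region[OF reg nop up down] .
    then show "word_separates \<tau> (word A) m p q"
      using neq unfolding word_separates_def by blast
  next
    assume "word_separates \<tau> (word A) m p q"
    then obtain b sig where reg: "word_region \<tau> (word A) m b sig" and neq: "b p \<noteq> b q"
      by (auto simp: word_separates_def)
    obtain mk where "region \<tau> A mk (\<lambda>e. sig (Suc e))" "\<forall>k. mk (walk A k) = b k"
      using region_of_word_region[OF reg] .
    then show "separable \<tau> A (walk A p) (walk A q)"
      using neq unfolding separable_def by blast
  qed
  have inh_iff: "inhibitable \<tau> A (walk A j) e \<longleftrightarrow> word_inhibits \<tau> (word A) m j (Suc e)"
    if "e \<in> events A" for j e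
  proof
    assume "inhibitable \<tau> A (walk A j) e"
    then obtain mk sig where reg: "region \<tau> A mk sig" and none: "interact (sig e) (mk (walk A j)) = None"
      by (auto simp: inhibitable_def)
    obtain sig' where "word_region \<tau> (word A) m (\<lambda>k. mk (walk A k)) sig'" "sig' (Suc e) = sig e"
      using word_region_of_region[OF reg nop up down] \<open>e \<in> events A\<close> by metis
    then show "word_inhibits \<tau> (word A) m j (Suc e)" unfolding word_inhibits_def
      using none by (intro exI[of _ "\<lambda>k. mk (walk A k)"] exI[of _ sig']) simp
  next
    assume "word_inhibits \<tau> (word A) m j (Suc e)"
    then obtain b sig where reg: "word_region \<tau> (word A) m b sig" and none: "interact (sig (Suc e)) (b j) = None"
      by (auto simp: word_inhibits_def)
    obtain mk where "region \<tau> A mk (\<lambda>e. sig (Suc e))" "\<forall>k. mk (walk A k) = b k"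
      using region_of_word_region[OF reg] .
    then show "inhibitable \<tau> A (walk A j) e" unfolding inhibitable_def
      using none by (intro exI[of _ mk] exI[of _ "\<lambda>e. sig (Suc e)"]) simp
  qed
  have none: "delta A (walk A j) e = None \<longleftrightarrow> word A j \<noteq> Suc e" for j e
    using walk_arc_iff[of j e] by (cases "delta A (walk A j) e") auto
  have ev: "e \<in> events A" if "word A k = Suc e" for k e
    using that walk_arc_iff transition_systemD(2)[OF A] by blast
  have inh_per: "word_inhibits \<tau> (word A) m (j mod m + m) a = word_inhibits \<tau> (word A) m j a" for j a
  proof -
    have eq: "b (j mod m + m) = b j" if "word_region \<tau> (word A) m b sig" for b sig
      using that periodic_mod[of b m j] by (simp add: word_region_def)
    show ?thesis unfolding word_inhibits_def by (intro ex_cong1 conj_cong refl) (simp only: eq)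
  qed
  show ?thesis
  proof
    assume sol: "tau_solvable \<tau> A"
    note regs = solvable_imp_regions[OF A sol]
    have "word_separates \<tau> (word A) m 0 q" if "0 < q" "q < m" for q
    proof -
      have "walk A 0 \<noteq> walk A q" using that by (simp add: walk_eq_iff)
      then show ?thesis using regs(1)[OF walk_in walk_in] sep_iff by blast
    qed
    then have ?prim by (rule primitive_if_separates[OF noswap])
    moreover have ?ess
    proof (intro allI impI, elim conjE)
      fix j k assume jk: "word A k \<noteq> 0" "word A j \<noteq> word A k"
      then obtain e where e: "word A k = Suc e" using not0_implies_Suc by blast
      then have "inhibitable \<tau> A (walk A j) e" using jk none by (intro regs(2) walk_in ev[OF e]) simp
      then show "word_inhibits \<tau> (word A) m j (word A k)" using inh_iff[OF ev[OF e]] e by simp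
    qed
    ultimately show "?prim \<and> ?ess" ..
  next
    assume R: "?prim \<and> ?ess"
    have ess: "word_inhibits \<tau> (word A) m j (word A k)" if "word A k \<noteq> 0" "word A j \<noteq> word A k" for j k
    proof -
      have mod: "word A (i mod m) = word A i" for i
        by (rule periodic_mod, rule word_period)
      have "j mod m < m" "k mod m < m" using m_pos by auto
      then show ?thesis
        using conjunct2[OF R, rule_format, of "j mod m + m" "k mod m"] that
        unfolding inh_per word_period mod by simp
    qed
    show "tau_solvable \<tau> A"
    proof (rule regions_imp_solvable[OF A])
      fix s s' assume s: "s \<in> states A" "s' \<in> states A" "s \<noteq> s'"
      then obtain p q where pq: "p < m" "q < m" "s = walk A p" "s' = walk A q" using states_eq by blast
      have *: "word_separates \<tau> (word A) m p q" if "p < q" "q < m" for p q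
        using separates_if_primitive[of "word A", OF word_period m_pos conjunct1[OF R] ess that] .
      have "p \<noteq> q" using s pq by blast
      then consider "p < q" | "q < p" by linarith
      then have "word_separates \<tau> (word A) m p q"
      proof cases
        case 2
        then have "word_separates \<tau> (word A) m q p" using * pq by blast
        then show ?thesis unfolding word_separates_def by metis
      qed (use * pq in blast)
      then show "separable \<tau> A s s'" using sep_iff pq by simp
    next
      fix s e assume s: "s \<in> states A" "e \<in> events A" "delta A s e = None"
      then obtain j where j: "s = walk A j" using states_walk by blast
      show "inhibitable \<tau> A s e"
      proof (cases "\<exists>k. word A k = Suc e")
        case True
        then obtain k where "word A k = Suc e" ..
        then show ?thesis using ess[of k j] s j none inh_iff by simp
      next
        case False
        \<comment> \<open>An event without occurrence is unconstrained: a place of constant value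
          \<open>v\<close> inhibits it by \<open>c\<close>.\<close>
        have "region \<tau> A (\<lambda>_. v) ((\<lambda>_. Nop)(e := c))"
          unfolding region_def
        proof (intro conjI ballI allI impI)
          fix s1 f s2 assume d: "delta A s1 f = Some s2"
          then obtain k where "s1 = walk A k" using transition_systemD(1)[OF A d] states_walk by blast
          then have "f \<noteq> e" using d False walk_arc_iff by blast
          then show "interact (((\<lambda>_. Nop)(e := c)) f) v = Some v" by simp
        qed (use nop inh in simp)
        then show ?thesis using inh unfolding inhibitable_def
          by (intro exI[of _ "\<lambda>_. v"] exI[of _ "(\<lambda>_. Nop)(e := c)"]) simp
      qed
    qed
  qed
qed

end

section \<open>Evaluating bounded formulas on a random access machine\<close>

fun code_at :: "instr list \<Rightarrow> nat \<Rightarrow> instr list \<Rightarrow> bool" where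
  "code_at P n [] \<longleftrightarrow> True"
| "code_at P n (i # is) \<longleftrightarrow> n < length P \<and> P ! n = i \<and> code_at P (Suc n) is"

lemma code_at_append [simp]:
  "code_at P n (xs @ ys) \<longleftrightarrow> code_at P n xs \<and> code_at P (n + length xs) ys"
  by (induction xs arbitrary: n) auto

lemma code_at_Cons: "code_at P n xs \<Longrightarrow> code_at (i # P) (Suc n) xs"
  by (induction xs arbitrary: n) auto

lemma code_at_self: "code_at P 0 P"
  by (induction P) (auto intro: code_at_Cons)

definition reaches :: "instr list \<Rightarrow> nat \<Rightarrow> config \<Rightarrow> config \<Rightarrow> bool" where
  "reaches P T c c' \<longleftrightarrow> (\<exists>t\<le>T. (step P ^^ t) c = c')"

lemma reaches_refl: "reaches P T c c"
  unfolding reaches_def by (rule exI[of _ 0]) simp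

lemma reaches_trans:
  assumes "reaches P T c c'" "reaches P T' c' c''"
  shows "reaches P (T + T') c c''"
proof -
  obtain t t' where "t \<le> T" "(step P ^^ t) c = c'" "t' \<le> T'" "(step P ^^ t') c' = c''"
    using assms by (auto simp: reaches_def)
  then show ?thesis unfolding reaches_def
    by (intro exI[of _ "t' + t"]) (simp add: funpow_add)
qed

lemma reaches_mono: "reaches P T c c' \<Longrightarrow> T \<le> T' \<Longrightarrow> reaches P T' c c'"
  unfolding reaches_def using order_trans by blast

lemma reaches_instr:
  assumes "code_at P n [i]"
  shows "reaches P 1 (n, X, w) (exec i (n, X, w))"
  unfolding reaches_def
  by (rule exI[of _ 1]) (use assms in \<open>auto simp: step_def halted_def\<close>)

fun straight :: "instr \<Rightarrow> bool" where
  "straight (JumpPos _ _) = False"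
| "straight _ = True"

definition effect :: "instr \<Rightarrow> (nat \<Rightarrow> nat) \<times> nat list \<Rightarrow> (nat \<Rightarrow> nat) \<times> nat list" where
  "effect i c = snd (exec i (0, c))"

lemma effect_simps [simp]:
  "effect (Const i c) (X, w) = (X(i := c), w)"
  "effect (Add i j k) (X, w) = (X(i := X j + X k), w)"
  "effect (Sub i j k) (X, w) = (X(i := X j - X k), w)"
  "effect (Load i j) (X, w) = (X(i := X (X j)), w)"
  "effect (Store i j) (X, w) = (X(X i := X j), w)"
  "effect (Read i) (X, x # w) = (X(i := x), w)"
  by (simp_all add: effect_def)

lemma reaches_straight:
  assumes "code_at P n is" "\<forall>i \<in> set is. straight i"
  shows "reaches P (length is) (n, c) (n + length is, fold effect is c)"
  using assms
proof (induction "is" arbitrary: n c)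
  case Nil then show ?case by (simp add: reaches_refl)
next
  case (Cons i "is")
  obtain X w where c: "c = (X, w)" by (cases c)
  have "exec i (n, c) = (Suc n, effect i c)"
    using Cons.prems by (cases i) (auto simp: effect_def c)
  then have "reaches P 1 (n, c) (Suc n, effect i c)"
    using reaches_instr[of P n i X w] Cons.prems c by simp
  from reaches_trans[OF this Cons.IH[of "Suc n"]] Cons.prems show ?case by simp
qed

lemma reaches_block:
  assumes "code_at P n is" "\<forall>i \<in> set is. straight i" "fold effect is c = c'" "length is = k" "n + k = n'"
  shows "reaches P k (n, c) (n', c')"
  using reaches_straight[OF assms(1,2), of c] assms(3-5) by simp

lemma reaches_jump:
  assumes "code_at P n [JumpPos j k]"
  shows "reaches P 1 (n, X, w) (if X j > 0 then k else Suc n, X, w)"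
  using reaches_instr[OF assms] by simp


section \<open>Bounded formulas and their compilation\<close>

datatype fm =
    Less nat nat
  | Sum nat nat nat
  | Same nat nat
  | Null nat
  | Neg fm
  | Conj fm fm
  | Exists nat fm

text \<open>The valuation will be the register file itself: a variable is the number of the register
  that holds its value.\<close>

fun sat :: "(nat \<Rightarrow> nat) \<Rightarrow> nat \<Rightarrow> (nat \<Rightarrow> nat) \<Rightarrow> fm \<Rightarrow> bool" where
  "sat W L v (Less i j) \<longleftrightarrow> v i < v j"
| "sat W L v (Sum i j k) \<longleftrightarrow> v i + v j = v k"
| "sat W L v (Same i j) \<longleftrightarrow> W (v i) = W (v j)"
| "sat W L v (Null i) \<longleftrightarrow> W (v i) = 0"
| "sat W L v (Neg f) \<longleftrightarrow> \<not> sat W L v f"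
| "sat W L v (Conj f g) \<longleftrightarrow> sat W L v f \<and> sat W L v g"
| "sat W L v (Exists r f) \<longleftrightarrow> (\<exists>x<L. sat W L (v(r := x)) f)"

text \<open>Bound variables are numbered by nesting depth and stored in the registers \<open>9, \<dots>, 31\<close>;
  the compiled code uses registers \<open>0, \<dots>, 3\<close> as scratch space and leaves the truth value in
  register 0. Registers \<open>4, \<dots>, 8\<close> contain \<open>1\<close>, the bound \<open>L\<close> of the quantifiers, the number
  of states, \<open>0\<close> and the base address \<open>34\<close> of the word, whose \<open>k\<close>-th letter has address
  \<open>34 + 3 * k\<close>.\<close>

fun wff :: "nat \<Rightarrow> fm \<Rightarrow> bool" where
  "wff d (Less i j) \<longleftrightarrow> {i, j} \<subseteq> {4..<d}"
| "wff d (Sum i j k) \<longleftrightarrow> {i, j, k} \<subseteq> {4..<d}"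
| "wff d (Same i j) \<longleftrightarrow> {i, j} \<subseteq> {9..<d}"
| "wff d (Null i) \<longleftrightarrow> i \<in> {9..<d}"
| "wff d (Neg f) \<longleftrightarrow> wff d f"
| "wff d (Conj f g) \<longleftrightarrow> wff d f \<and> wff d g"
| "wff d (Exists r f) \<longleftrightarrow> r = d \<and> d \<in> {9..<32} \<and> wff (Suc d) f"

text \<open>Jumps are absolute, hence the start address \<open>n\<close>. With truncated
  subtraction, \<open>(x - y) + (y - x)\<close> is 0 exactly if \<open>x = y\<close>. The loop for
  \<open>Exists\<close> counts down from \<open>L - 1\<close> with the register of the variable as
  counter and leaves as soon as the body holds; falling through at 0 leaves the negative answer in
  register 0.\<close>

primrec compile :: "fm \<Rightarrow> nat \<Rightarrow> instr list" where
  "compile (Less i j) n = [Sub 0 j i]"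
| "compile (Sum i j k) n = [Add 1 i j, Sub 0 1 k, Sub 2 k 1, Add 0 0 2, Sub 0 4 0]"
| "compile (Same i j) n =
     [Add 1 i i, Add 1 1 i, Add 1 1 8, Load 1 1, Add 2 j j, Add 2 2 j, Add 2 2 8, Load 2 2,
      Sub 0 1 2, Sub 3 2 1, Add 0 0 3, Sub 0 4 0]"
| "compile (Null i) n = [Add 1 i i, Add 1 1 i, Add 1 1 8, Load 1 1, Sub 0 4 1]"
| "compile (Neg f) n = compile f n @ [Sub 0 4 0]"
| "compile (Conj f g) n =
     (let a = compile f n; k = n + length a + 2; b = compile g k
      in a @ [JumpPos 0 k, JumpPos 4 (k + length b)] @ b)"
| "compile (Exists r f) n =
     (let a = compile f (n + 2)
      in [Add r 5 7, Sub r r 4] @ a @ [JumpPos 0 (n + 4 + length a), JumpPos r (n + 1)])"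

text \<open>12 is the length of the code for \<open>Same\<close>, the longest atom. A pass of the
  \<open>Exists\<close> loop adds a decrement and two jumps.\<close>

fun cost :: "fm \<Rightarrow> nat poly" where
  "cost (Neg f) = cost f + 1"
| "cost (Conj f g) = cost f + cost g + 2"
| "cost (Exists r f) = [:0, 1:] * (cost f + 3) + 1"
| "cost _ = [:12:]"

definition table :: "(nat \<Rightarrow> nat) \<Rightarrow> nat \<Rightarrow> nat \<Rightarrow> (nat \<Rightarrow> nat) \<Rightarrow> bool" where
  "table W L d X \<longleftrightarrow> X 4 = 1 \<and> X 5 = L \<and> X 7 = 0 \<and> X 8 = 34 \<and>
     (\<forall>k<L. X (34 + 3 * k) = W k) \<and> (\<forall>i \<in> {9..<d}. X i < L)"

definition preserves :: "nat \<Rightarrow> (nat \<Rightarrow> nat) \<Rightarrow> (nat \<Rightarrow> nat) \<Rightarrow> bool" where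
  "preserves d X Y \<longleftrightarrow> (\<forall>a. 4 \<le> a \<and> a \<notin> {d..<32} \<longrightarrow> Y a = X a)"

lemma preserves_trans: "preserves d X Y \<Longrightarrow> preserves d Y Z \<Longrightarrow> preserves d X Z"
  by (simp add: preserves_def)

lemma table_preserves:
  assumes "table W L d X" "preserves d X Y" "9 \<le> d" "d \<le> 32"
  shows "table W L d Y"
  using assms by (auto simp: table_def preserves_def)

lemma sat_cong:
  assumes "wff d f" "\<forall>a \<in> {4..<d}. v a = v' a"
  shows "sat W L v f \<longleftrightarrow> sat W L v' f"
  using assms
proof (induction f arbitrary: d v v')
  case (Exists r f)
  have "sat W L (v(r := x)) f \<longleftrightarrow> sat W L (v'(r := x)) f" for x
  proof (rule Exists.IH)
    show "wff (Suc d) f" using Exists.prems by simp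
    show "\<forall>a \<in> {4..<Suc d}. (v(r := x)) a = (v'(r := x)) a"
      using Exists.prems by (auto simp: less_Suc_eq)
  qed
  then show ?case by simp
next
  case (Neg f)
  have "sat W L v f \<longleftrightarrow> sat W L v' f"
    using Neg.prems by (intro Neg.IH) simp_all
  then show ?case by simp
next
  case (Conj f g)
  have "sat W L v f \<longleftrightarrow> sat W L v' f" "sat W L v g \<longleftrightarrow> sat W L v' g"
    using Conj.prems by (intro Conj.IH; simp)+
  then show ?case by simp
qed simp_all

lemma sat_preserves:
  assumes "wff d f" "preserves d X Y" "d \<le> 32"
  shows "sat W L Y f \<longleftrightarrow> sat W L X f"
  using assms(2,3) by (intro sat_cong[OF assms(1)]) (simp add: preserves_def)

lemma compile_atom:
  assumes "code_at P n (compile f n)" "fold effect (compile f n) (X, w) = (Y, w)"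
    and "\<forall>i \<in> set (compile f n). straight i" "cost f = [:12:]" "length (compile f n) \<le> 12"
    and "Y 0 > 0 \<longleftrightarrow> sat W L X f" "preserves d X Y"
  shows "\<exists>Y. reaches P (poly (cost f) L) (n, X, w) (n + length (compile f n), Y, w) \<and>
    (Y 0 > 0 \<longleftrightarrow> sat W L X f) \<and> preserves d X Y"
proof (intro exI[of _ Y] conjI assms(6,7))
  have "reaches P (length (compile f n)) (n, X, w) (n + length (compile f n), Y, w)"
    using reaches_straight[OF assms(1,3), of "(X, w)"] by (simp only: assms(2))
  moreover have "length (compile f n) \<le> poly (cost f) L"
    using assms(5) by (simp only: assms(4) poly_pCons poly_0)
  ultimately show "reaches P (poly (cost f) L) (n, X, w) (n + length (compile f n), Y, w)"
    by (rule reaches_mono)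
qed

lemma compile_correct:
  assumes "code_at P n (compile f n)" "wff d f" "table W L d X" "9 \<le> d" "d \<le> 32" "0 < L"
  shows "\<exists>Y. reaches P (poly (cost f) L) (n, X, w) (n + length (compile f n), Y, w) \<and>
    (Y 0 > 0 \<longleftrightarrow> sat W L X f) \<and> preserves d X Y"
  using assms
proof (induction f arbitrary: n d X)
  case (Less i j)
  let ?Y = "X(0 := X j - X i)"
  show ?case
    by (rule compile_atom[of _ _ _ _ _ ?Y]) (use Less.prems in \<open>simp_all add: preserves_def\<close>)
next
  case (Sum i j k)
  let ?s = "X i + X j"
  let ?Y = "X(1 := ?s, 2 := X k - ?s, 0 := 1 - (?s - X k + (X k - ?s)))"
  have "4 \<le> i" "4 \<le> j" "4 \<le> k" "X 4 = 1" using Sum.prems by (simp_all add: table_def)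
  then show ?case
    by (intro compile_atom[of _ _ _ _ _ ?Y]) (use Sum.prems in \<open>auto simp: preserves_def fun_eq_iff\<close>)
next
  case (Same i j)
  have W: "X (34 + 3 * k) = W k" if "k < L" for k
    using Same.prems that by (simp add: table_def)
  have ij: "9 \<le> i" "9 \<le> j" "X i < L" "X j < L" "X 4 = 1" "X 8 = 34"
    using Same.prems by (simp_all add: table_def)
  have mem: "X (X i + X i + X i + 34) = W (X i)" "X (X j + X j + X j + 34) = W (X j)"
    using W[OF ij(3)] W[OF ij(4)] by (simp_all add: algebra_simps)
  let ?Y = "X(1 := W (X i), 2 := W (X j), 3 := W (X j) - W (X i),
    0 := 1 - (W (X i) - W (X j) + (W (X j) - W (X i))))"
  show ?case
    by (rule compile_atom[of _ _ _ _ _ ?Y]) (use Same.prems ij mem in \<open>auto simp: preserves_def fun_eq_iff\<close>)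
next
  case (Null i)
  have W: "X (34 + 3 * k) = W k" if "k < L" for k
    using Null.prems that by (simp add: table_def)
  have i: "9 \<le> i" "X i < L" "X 4 = 1" "X 8 = 34"
    using Null.prems by (simp_all add: table_def)
  have mem: "X (X i + X i + X i + 34) = W (X i)"
    using W[OF i(2)] by (simp add: algebra_simps)
  let ?Y = "X(1 := W (X i), 0 := 1 - W (X i))"
  show ?case
    by (rule compile_atom[of _ _ _ _ _ ?Y]) (use Null.prems i mem in \<open>auto simp: preserves_def fun_eq_iff\<close>)
next
  case (Neg f)
  have "code_at P n (compile f n)" "wff d f" using Neg.prems by simp_all
  from Neg.IH[OF this Neg.prems(3-6)] obtain Y where Y:
    "reaches P (poly (cost f) L) (n, X, w) (n + length (compile f n), Y, w)"
    "Y 0 > 0 \<longleftrightarrow> sat W L X f" "preserves d X Y"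
    by (elim exE conjE)
  have "reaches P 1 (n + length (compile f n), Y, w) (Suc (n + length (compile f n)), Y(0 := Y 4 - Y 0), w)"
    using reaches_instr[of P "n + length (compile f n)" "Sub 0 4 0"] Neg.prems by simp
  from reaches_trans[OF Y(1) this]
  have "reaches P (poly (cost (Neg f)) L) (n, X, w)
    (n + length (compile (Neg f) n), Y(0 := Y 4 - Y 0), w)" by simp
  moreover have "table W L d Y" by (rule table_preserves) (fact Neg.prems Y(3))+
  then have "(Y(0 := Y 4 - Y 0)) 0 > 0 \<longleftrightarrow> sat W L X (Neg f)"
    using Y(2) unfolding table_def by (cases "sat W L X f") simp_all
  moreover have "preserves d X (Y(0 := Y 4 - Y 0))" using Y(3) by (simp add: preserves_def)
  ultimately show ?case by (intro exI[of _ "Y(0 := Y 4 - Y 0)"] conjI)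
next
  case (Conj f g)
  define a where "a = compile f n"
  define k where "k = n + length a + 2"
  define b where "b = compile g k"
  have code: "code_at P n a" "code_at P (n + length a) [JumpPos 0 k]"
    "code_at P (Suc (n + length a)) [JumpPos 4 (k + length b)]" "code_at P k b"
    using Conj.prems by (simp_all add: Let_def a_def b_def k_def)
  have wf: "wff d f" "wff d g" using Conj.prems by simp_all
  have len: "n + length (compile (Conj f g) n) = k + length b"
    by (simp add: Let_def a_def b_def k_def)
  obtain Y where Y: "reaches P (poly (cost f) L) (n, X, w) (n + length a, Y, w)"
    "Y 0 > 0 \<longleftrightarrow> sat W L X f" "preserves d X Y"
    using Conj.IH(1)[OF code(1)[unfolded a_def] wf(1) Conj.prems(3-6)] unfolding a_def by (elim exE conjE)
  have tY: "table W L d Y" by (rule table_preserves) (fact Conj.prems Y(3))+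
  note j1 = reaches_trans[OF Y(1) reaches_jump[OF code(2)]]
  show ?case
  proof (cases "Y 0 > 0")
    case True
    obtain Z where Z: "reaches P (poly (cost g) L) (k, Y, w) (k + length b, Z, w)"
      "Z 0 > 0 \<longleftrightarrow> sat W L Y g" "preserves d Y Z"
      using Conj.IH(2)[OF code(4)[unfolded b_def] wf(2) tY Conj.prems(4-6)] unfolding b_def by (elim exE conjE)
    have "reaches P (poly (cost f) L + 1 + poly (cost g) L) (n, X, w) (k + length b, Z, w)"
      using reaches_trans[OF j1, of _ "(k + length b, Z, w)"] Z(1) True by simp
    then have "reaches P (poly (cost (Conj f g)) L) (n, X, w) (k + length b, Z, w)"
      by (rule reaches_mono) simp
    moreover have "sat W L Y g \<longleftrightarrow> sat W L X g"
      using Y(3) Conj.prems by (intro sat_preserves) auto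
    then have "Z 0 > 0 \<longleftrightarrow> sat W L X (Conj f g)" using Z(2) Y(2) True by simp
    ultimately show ?thesis using preserves_trans[OF Y(3) Z(3)] unfolding len
      by (intro exI[of _ Z] conjI)
  next
    case False
    have "Y 4 > 0" using tY by (simp add: table_def)
    then have "reaches P (poly (cost f) L + 1 + 1) (n, X, w) (k + length b, Y, w)"
      using reaches_trans[OF j1, of 1 "(k + length b, Y, w)"] reaches_jump[OF code(3), of Y w] False by simp
    then have "reaches P (poly (cost (Conj f g)) L) (n, X, w) (k + length b, Y, w)"
      by (rule reaches_mono) simp
    moreover have "Y 0 > 0 \<longleftrightarrow> sat W L X (Conj f g)" using Y(2) False by simp
    ultimately show ?thesis using Y(3) unfolding len by (intro exI[of _ Y] conjI)
  qed
next
  case (Exists r f)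
  define a where "a = compile f (n + 2)"
  define e where "e = n + 4 + length a"
  define T where "T = poly (cost f) L"
  have e_Suc: "e = Suc (Suc (n + 2 + length a))" by (simp add: e_def)
  have code: "code_at P n [Add r 5 7]" "code_at P (n + 1) [Sub r r 4]" "code_at P (n + 2) a"
    "code_at P (n + 2 + length a) [JumpPos 0 e]" "code_at P (Suc (n + 2 + length a)) [JumpPos r (n + 1)]"
    using Exists.prems by (simp_all add: Let_def a_def e_def)
  have len: "n + length (compile (Exists r f) n) = e" by (simp add: Let_def a_def e_def)
  have r: "r = d" "9 \<le> d" "d < 32" "wff (Suc d) f" using Exists.prems by auto
  \<comment> \<open>One pass of the loop decrements the counter \<open>Suc x\<close> and tests
    \<open>x\<close>. Variables bound inside the body have registers above \<open>r\<close>, so the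
    counter survives.\<close>
  have iter: "\<exists>Y. reaches P (T + 1) (n + 1, Z, w) (n + 2 + length a, Y, w) \<and>
      (Y 0 > 0 \<longleftrightarrow> sat W L (X(r := x)) f) \<and> preserves d X Y \<and> Y r = x"
    if Z: "Z r = Suc x" "Suc x \<le> L" "preserves d X Z" for x Z
  proof -
    have tZ: "table W L d Z" by (rule table_preserves) (fact Exists.prems Z(3))+
    then have "Z 4 = 1" by (simp add: table_def)
    then have 1: "reaches P 1 (n + 1, Z, w) (n + 2, Z(r := x), w)"
      using reaches_instr[OF code(2), of Z w] Z(1) by simp
    have "table W L (Suc d) (Z(r := x))"
      using tZ r Z(2) by (auto simp: table_def less_Suc_eq)
    moreover have "9 \<le> Suc d" "Suc d \<le> 32" using r by simp_all
    ultimately have IH: "\<exists>Y. reaches P (poly (cost f) L) (n + 2, Z(r := x), w)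
        (n + 2 + length (compile f (n + 2)), Y, w) \<and> (Y 0 > 0 \<longleftrightarrow> sat W L (Z(r := x)) f) \<and>
        preserves (Suc d) (Z(r := x)) Y"
      using code(3)[unfolded a_def] r(4) Exists.prems(6) by (intro Exists.IH)
    obtain Y where Y: "reaches P T (n + 2, Z(r := x), w) (n + 2 + length a, Y, w)"
      "Y 0 > 0 \<longleftrightarrow> sat W L (Z(r := x)) f" "preserves (Suc d) (Z(r := x)) Y"
      using IH unfolding a_def T_def by (elim exE conjE)
    have "sat W L (Z(r := x)) f \<longleftrightarrow> sat W L (X(r := x)) f"
      using Z(3) r by (intro sat_preserves[of "Suc d"]) (auto simp: preserves_def)
    moreover have "preserves d X Y" "Y r = x"
      using Y(3) Z(3) r by (auto simp: preserves_def)
    moreover have "reaches P (T + 1) (n + 1, Z, w) (n + 2 + length a, Y, w)"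
      using reaches_trans[OF 1 Y(1)] by (simp add: add.commute)
    ultimately show ?thesis using Y(2) by (intro exI[of _ Y] conjI) simp_all
  qed
  have loop: "\<exists>Y. reaches P (Suc x * (T + 3)) (n + 1, Z, w) (e, Y, w) \<and>
      (Y 0 > 0 \<longleftrightarrow> (\<exists>y\<le>x. sat W L (X(r := y)) f)) \<and> preserves d X Y"
    if "Z r = Suc x" "Suc x \<le> L" "preserves d X Z" for x Z
    using that
  proof (induction x arbitrary: Z)
    case (0 Z)
    obtain Y where Y: "reaches P (T + 1) (n + 1, Z, w) (n + 2 + length a, Y, w)"
      "Y 0 > 0 \<longleftrightarrow> sat W L (X(r := 0)) f" "preserves d X Y" "Y r = 0"
      using iter[OF 0] by (elim exE conjE)
    have "reaches P (T + 1 + 1 + 1) (n + 1, Z, w) (e, Y, w)"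
    proof (cases "Y 0 > 0")
      case True
      then show ?thesis
        using reaches_trans[OF Y(1) reaches_jump[OF code(4)]] by (auto intro: reaches_mono)
    next
      case False
      then show ?thesis
        using reaches_trans[OF reaches_trans[OF Y(1) reaches_jump[OF code(4)]], of 1 "(e, Y, w)"]
          reaches_jump[OF code(5), of Y w] Y(4) by (simp add: e_Suc)
    qed
    then have "reaches P (Suc 0 * (T + 3)) (n + 1, Z, w) (e, Y, w)"
      by (rule reaches_mono) simp
    moreover have "Y 0 > 0 \<longleftrightarrow> (\<exists>y\<le>0. sat W L (X(r := y)) f)" using Y(2) by simp
    ultimately show ?case using Y(3) by (intro exI[of _ Y] conjI)
  next
    case (Suc x Z)
    obtain Y where Y: "reaches P (T + 1) (n + 1, Z, w) (n + 2 + length a, Y, w)"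
      "Y 0 > 0 \<longleftrightarrow> sat W L (X(r := Suc x)) f" "preserves d X Y" "Y r = Suc x"
      using iter[OF Suc.prems] by (elim exE conjE)
    show ?case
    proof (cases "Y 0 > 0")
      case True
      then have "reaches P (T + 1 + 1) (n + 1, Z, w) (e, Y, w)"
        using reaches_trans[OF Y(1) reaches_jump[OF code(4)]] by simp
      then have "reaches P (Suc (Suc x) * (T + 3)) (n + 1, Z, w) (e, Y, w)"
        by (rule reaches_mono) simp
      moreover have "Y 0 > 0 \<longleftrightarrow> (\<exists>y\<le>Suc x. sat W L (X(r := y)) f)" using Y(2) True by blast
      ultimately show ?thesis using Y(3) by (intro exI[of _ Y] conjI)
    next
      case False
      have s1: "reaches P (T + 1 + 1 + 1) (n + 1, Z, w) (n + 1, Y, w)"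
        using reaches_trans[OF reaches_trans[OF Y(1) reaches_jump[OF code(4)]], of 1 "(n + 1, Y, w)"]
          reaches_jump[OF code(5), of Y w] Y(4) False by simp
      obtain U where U: "reaches P (Suc x * (T + 3)) (n + 1, Y, w) (e, U, w)"
        "U 0 > 0 \<longleftrightarrow> (\<exists>y\<le>x. sat W L (X(r := y)) f)" "preserves d X U"
        using Suc.IH[OF Y(4) Suc_leD[OF Suc.prems(2)] Y(3)] by (elim exE conjE)
      from reaches_trans[OF s1 U(1)] have "reaches P (Suc (Suc x) * (T + 3)) (n + 1, Z, w) (e, U, w)"
        by (rule reaches_mono) simp
      moreover have "U 0 > 0 \<longleftrightarrow> (\<exists>y\<le>Suc x. sat W L (X(r := y)) f)"
        using U(2) Y(2) False by (auto simp: le_Suc_eq)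
      ultimately show ?thesis using U(3) by (intro exI[of _ U] conjI)
    qed
  qed
  have s1: "reaches P 1 (n, X, w) (n + 1, X(r := L), w)"
    using reaches_instr[OF code(1), of X w] Exists.prems by (simp add: table_def)
  obtain x where x: "L = Suc x" using Exists.prems by (cases L) auto
  have "preserves d X (X(r := L))" using r by (simp add: preserves_def)
  from loop[of "X(r := L)" x, folded x, OF _ _ this]
  obtain Y where Y: "reaches P (L * (T + 3)) (n + 1, X(r := L), w) (e, Y, w)"
    "Y 0 > 0 \<longleftrightarrow> (\<exists>y\<le>x. sat W L (X(r := y)) f)" "preserves d X Y"
    by auto
  from reaches_trans[OF s1 Y(1)] have "reaches P (poly (cost (Exists r f)) L) (n, X, w) (e, Y, w)"
    by (simp add: T_def)
  moreover have "Y 0 > 0 \<longleftrightarrow> sat W L X (Exists r f)" using Y(2) x by (auto simp: less_Suc_eq_le)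
  ultimately show ?case using Y(3) unfolding len by (intro exI[of _ Y] conjI)
qed

section \<open>Extracting the word from the input\<close>

lemma poly_nat_mono:
  fixes p :: "nat poly"
  assumes "x \<le> y"
  shows "poly p x \<le> poly p y"
  by (induction p) (use assms in \<open>auto intro: mult_mono add_mono\<close>)

text \<open>Reads the input and stores the label and the successor of each state \<open>s\<close> at the addresses
  \<open>32 + 3 * s\<close> and \<open>33 + 3 * s\<close>; these never interfere with the word, which is then obtained by
  walking twice around the cycle. The jump targets 9, 14, 26, 30, 39 are absolute.\<close>

definition loader :: "instr list" where
  "loader =
    [Const 4 1, Const 8 34, Const 11 32, Const 12 3, Read 6, Read 9, Read 10, Read 13, Add 1 6 9] @
    [Read 2, Sub 1 1 4] @ [JumpPos 1 9] @ [JumpPos 10 14] @ [JumpPos 4 26] @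
    [Read 1, Read 2, Read 3, Add 0 1 1, Add 0 0 1, Add 0 0 11, Add 2 2 4, Store 0 2, Add 0 0 4,
     Store 0 3, Sub 10 10 4] @ [JumpPos 10 14] @
    [Add 5 6 6, Add 1 13 7, Add 2 8 7, Add 3 5 7] @
    [Add 0 1 1, Add 0 0 1, Add 0 0 11, Load 9 0, Store 2 9, Add 0 0 4, Load 1 0] @
    [JumpPos 9 39] @ [Add 1 13 7] @ [Add 2 2 12, Sub 3 3 4] @ [JumpPos 3 30]"

lemma length_loader: "length loader = 42"
  by (simp add: loader_def)

lemma loader_code:
  assumes "code_at P 0 loader"
  shows "code_at P 0 [Const 4 1, Const 8 34, Const 11 32, Const 12 3, Read 6, Read 9, Read 10, Read 13, Add 1 6 9]"
    and "code_at P 9 [Read 2, Sub 1 1 4]" "code_at P 11 [JumpPos 1 9]" "code_at P 12 [JumpPos 10 14]"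
    and "code_at P 13 [JumpPos 4 26]"
    and "code_at P 14 [Read 1, Read 2, Read 3, Add 0 1 1, Add 0 0 1, Add 0 0 11, Add 2 2 4,
      Store 0 2, Add 0 0 4, Store 0 3, Sub 10 10 4]"
    and "code_at P 25 [JumpPos 10 14]"
    and "code_at P 26 [Add 5 6 6, Add 1 13 7, Add 2 8 7, Add 3 5 7]"
    and "code_at P 30 [Add 0 1 1, Add 0 0 1, Add 0 0 11, Load 9 0, Store 2 9, Add 0 0 4, Load 1 0]"
    and "code_at P 37 [JumpPos 9 39]" "code_at P 38 [Add 1 13 7]"
    and "code_at P 39 [Add 2 2 12, Sub 3 3 4]" "code_at P 41 [JumpPos 3 30]"
  using assms unfolding loader_def code_at_append
  by (simp_all del: code_at.simps add: eval_nat_numeral)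

text \<open>Walking along the arcs from the initial state reproduces the cyclic word, so the lists
  of states and events are skipped.\<close>

lemma skip_loop:
  assumes code: "code_at P 9 [Read 2, Sub 1 1 4]" "code_at P 11 [JumpPos 1 9]"
    and "X 1 = length xs" "xs \<noteq> []" "X 4 = 1"
  shows "\<exists>Y. reaches P (3 * length xs) (9, X, xs @ w) (12, Y, w) \<and> (\<forall>a. a \<notin> {1, 2} \<longrightarrow> Y a = X a)"
  using assms(3-5)
proof (induction xs arbitrary: X)
  case (Cons x xs)
  define Y where "Y = X(2 := x, 1 := length xs)"
  have Y: "Y 1 = length xs" "Y 4 = 1" "\<forall>a. a \<notin> {1, 2} \<longrightarrow> Y a = X a"
    using Cons.prems by (simp_all add: Y_def)
  have "reaches P 2 (9, X, (x # xs) @ w) (11, Y, xs @ w)"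
    using Cons.prems by (intro reaches_block[OF code(1)]) (simp_all add: Y_def)
  from reaches_trans[OF this reaches_jump[OF code(2)]]
  have 1: "reaches P 3 (9, X, (x # xs) @ w) (if xs = [] then 12 else 9, Y, xs @ w)"
    using Y(1) by (cases "xs = []") simp_all
  show ?case
  proof (cases "xs = []")
    case True
    then show ?thesis using 1 Y(3) by (intro exI[of _ Y]) simp
  next
    case False
    from Cons.IH[OF Y(1) this Y(2)] obtain Z where
      Z: "reaches P (3 * length xs) (9, Y, xs @ w) (12, Z, w)" "\<forall>a. a \<notin> {1, 2} \<longrightarrow> Z a = Y a"
      by (elim exE conjE)
    have "reaches P (3 + 3 * length xs) (9, X, (x # xs) @ w) (12, Z, w)"
      using reaches_trans[OF _ Z(1), of 3] 1 False by simp
    then have "reaches P (3 * length (x # xs)) (9, X, (x # xs) @ w) (12, Z, w)" by simp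
    moreover have "\<forall>a. a \<notin> {1, 2} \<longrightarrow> Z a = X a" using Z(2) Y(3) by simp
    ultimately show ?thesis by (intro exI[of _ Z] conjI)
  qed
qed simp

text \<open>Distinct sources mean that no entry is overwritten; this is where out-degree at most one
  enters. States without an outgoing arc keep their initial 0, the label of the fictitious
  arc.\<close>

lemma arc_loop:
  assumes code: "code_at P 14 [Read 1, Read 2, Read 3, Add 0 1 1, Add 0 0 1, Add 0 0 11, Add 2 2 4,
      Store 0 2, Add 0 0 4, Store 0 3, Sub 10 10 4]" "code_at P 25 [JumpPos 10 14]"
    and "X 10 = length as" "as \<noteq> []" "X 4 = 1" "X 11 = 32" "distinct (map fst as)"
  shows "\<exists>Y. reaches P (12 * length as) (14, X, concat (map (\<lambda>(s, e, s'). [s, e, s']) as) @ w) (26, Y, w) \<and>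
    (\<forall>a. 4 \<le> a \<and> a < 32 \<and> a \<noteq> 10 \<longrightarrow> Y a = X a) \<and>
    (\<forall>(s, e, s') \<in> set as. Y (32 + 3 * s) = Suc e \<and> Y (33 + 3 * s) = s') \<and>
    (\<forall>s. s \<notin> fst ` set as \<longrightarrow> Y (32 + 3 * s) = X (32 + 3 * s) \<and> Y (33 + 3 * s) = X (33 + 3 * s))"
  using assms(3-7)
proof (induction as arbitrary: X)
  case (Cons x as)
  obtain s e s' where x: "x = (s, e, s')" by (cases x)
  let ?in = "concat (map (\<lambda>(s, e, s'). [s, e, s']) (x # as)) @ w"
  let ?rest = "concat (map (\<lambda>(s, e, s'). [s, e, s']) as) @ w"
  define Y where "Y = X(1 := s, 2 := Suc e, 3 := s', 0 := 33 + 3 * s, 32 + 3 * s := Suc e, 33 + 3 * s := s',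
    10 := length as)"
  have Y: "Y 10 = length as" "Y 4 = 1" "Y 11 = 32"
    using Cons.prems by (simp_all add: Y_def)
  have keep: "\<forall>a. 4 \<le> a \<and> a < 32 \<and> a \<noteq> 10 \<longrightarrow> Y a = X a" by (simp add: Y_def)
  have new: "Y (32 + 3 * s) = Suc e" "Y (33 + 3 * s) = s'" by (simp_all add: Y_def)
  have old: "Y (32 + 3 * t) = X (32 + 3 * t)" "Y (33 + 3 * t) = X (33 + 3 * t)" if "t \<noteq> s" for t
  proof -
    \<comment> \<open>Labels and successors have addresses in different residue classes modulo 3;
      the third class, from 34 on, is left to the word.\<close>
    have "32 + 3 * t \<noteq> 33 + 3 * s" "33 + 3 * t \<noteq> 32 + 3 * s" by presburger+
    then show "Y (32 + 3 * t) = X (32 + 3 * t)" "Y (33 + 3 * t) = X (33 + 3 * t)"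
      using that by (simp_all add: Y_def)
  qed
  have "reaches P 11 (14, X, ?in) (25, Y, ?rest)"
  proof -
    have "s + s + s + 32 = 32 + 3 * s" by simp
    then have "fold effect [Read 1, Read 2, Read 3, Add 0 1 1, Add 0 0 1, Add 0 0 11, Add 2 2 4,
      Store 0 2, Add 0 0 4, Store 0 3, Sub 10 10 4] (X, ?in) = (Y, ?rest)"
      using Cons.prems by (auto simp: x Y_def fun_eq_iff)
    then show ?thesis by (intro reaches_block[OF code(1)]) simp_all
  qed
  from reaches_trans[OF this reaches_jump[OF code(2)]]
  have 1: "reaches P 12 (14, X, ?in) (if as = [] then 26 else 14, Y, ?rest)"
    using Y(1) by (cases "as = []") simp_all
  show ?case
  proof (cases "as = []")
    case True
    have "reaches P (12 * length (x # as)) (14, X, ?in) (26, Y, w)" using 1 True by simp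
    then show ?thesis using keep new old True by (intro exI[of _ Y] conjI) (simp_all add: x)
  next
    case False
    have dist: "distinct (map fst as)" "s \<notin> fst ` set as" using Cons.prems by (auto simp: x)
    from Cons.IH[OF Y(1) False Y(2,3) dist(1)] obtain Z where
      Z: "reaches P (12 * length as) (14, Y, ?rest) (26, Z, w)"
      "\<forall>a. 4 \<le> a \<and> a < 32 \<and> a \<noteq> 10 \<longrightarrow> Z a = Y a"
      "\<forall>(s, e, s') \<in> set as. Z (32 + 3 * s) = Suc e \<and> Z (33 + 3 * s) = s'"
      "\<forall>s. s \<notin> fst ` set as \<longrightarrow> Z (32 + 3 * s) = Y (32 + 3 * s) \<and> Z (33 + 3 * s) = Y (33 + 3 * s)"
      by (elim exE conjE)
    have "reaches P (12 + 12 * length as) (14, X, ?in) (26, Z, w)"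
      using reaches_trans[OF _ Z(1), of 12] 1 False by simp
    then have "reaches P (12 * length (x # as)) (14, X, ?in) (26, Z, w)" by simp
    moreover have "\<forall>a. 4 \<le> a \<and> a < 32 \<and> a \<noteq> 10 \<longrightarrow> Z a = X a" using Z(2) keep by simp
    moreover have "Z (32 + 3 * s) = Suc e" "Z (33 + 3 * s) = s'" using Z(4) dist(2) new by auto
    then have "\<forall>(s, e, s') \<in> set (x # as). Z (32 + 3 * s) = Suc e \<and> Z (33 + 3 * s) = s'"
      using Z(3) by (simp add: x)
    moreover have "\<forall>t. t \<notin> fst ` set (x # as) \<longrightarrow> Z (32 + 3 * t) = X (32 + 3 * t) \<and> Z (33 + 3 * t) = X (33 + 3 * t)"
      using Z(4) old by (simp add: x)
    ultimately show ?thesis by (intro exI[of _ Z] conjI)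
  qed
qed simp

text \<open>\<open>k\<close> letters have been written and \<open>Suc n\<close> remain. Where the
  label is 0, register 1 is set to \<open>s0\<close>, which carries out the fictitious arc. A pass
  takes at most 7 + 1 + 1 + 2 + 1 = 12 steps.\<close>

lemma walk_loop:
  assumes code: "code_at P 30 [Add 0 1 1, Add 0 0 1, Add 0 0 11, Load 9 0, Store 2 9, Add 0 0 4, Load 1 0]"
      "code_at P 37 [JumpPos 9 39]" "code_at P 38 [Add 1 13 7]"
      "code_at P 39 [Add 2 2 12, Sub 3 3 4]" "code_at P 41 [JumpPos 3 30]"
    and st: "\<And>k. st (Suc k) = (if ev (st k) = 0 then s0 else nx (st k))"
    and "X 4 = 1" "X 7 = 0" "X 11 = 32" "X 12 = 3" "X 13 = s0"
    and "X 3 = Suc n" "X 1 = st k" "X 2 = 34 + 3 * k"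
    and "\<forall>s. X (32 + 3 * s) = ev s" "\<forall>s. ev s \<noteq> 0 \<longrightarrow> X (33 + 3 * s) = nx s"
    and "\<forall>j<k. X (34 + 3 * j) = ev (st j)"
  shows "\<exists>Y. reaches P (12 * Suc n) (30, X, w) (42, Y, w) \<and>
    (\<forall>a. 4 \<le> a \<and> a < 32 \<and> a \<noteq> 9 \<longrightarrow> Y a = X a) \<and> (\<forall>j < k + Suc n. Y (34 + 3 * j) = ev (st j))"
  using assms(7-)
proof (induction n arbitrary: X k)
  have iter: "\<exists>Y. reaches P 12 (30, X, w) (if n = 0 then 42 else 30, Y, w) \<and>
      Y 3 = n \<and> Y 1 = st (Suc k) \<and> Y 2 = 34 + 3 * Suc k \<and>
      (\<forall>a. 4 \<le> a \<and> a < 32 \<and> a \<noteq> 9 \<longrightarrow> Y a = X a) \<and>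
      (\<forall>s. Y (32 + 3 * s) = X (32 + 3 * s)) \<and> (\<forall>s. Y (33 + 3 * s) = X (33 + 3 * s)) \<and>
      (\<forall>j \<le> k. Y (34 + 3 * j) = ev (st j))"
    if X: "X 4 = 1" "X 7 = 0" "X 11 = 32" "X 12 = 3" "X 13 = s0"
      "X 3 = Suc n" "X 1 = st k" "X 2 = 34 + 3 * k"
      "\<forall>s. X (32 + 3 * s) = ev s" "\<forall>s. ev s \<noteq> 0 \<longrightarrow> X (33 + 3 * s) = nx s"
      "\<forall>j<k. X (34 + 3 * j) = ev (st j)" for X n k
  proof -
    let ?s = "st k"
    define Y1 where "Y1 = X(0 := 33 + 3 * ?s, 9 := ev ?s, 34 + 3 * k := ev ?s, 1 := X (33 + 3 * ?s))"
    define Y where "Y = Y1(1 := st (Suc k), 2 := 34 + 3 * Suc k, 3 := n)"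
    have mem: "X (3 * ?s + 32) = ev ?s" using X(9)[rule_format, of ?s] by (simp add: add.commute)
    have adr: "?s + ?s + ?s + 32 = 32 + 3 * ?s" "33 + 3 * ?s \<noteq> 34 + 3 * k" by presburger+
    have "fold effect [Add 0 1 1, Add 0 0 1, Add 0 0 11, Load 9 0, Store 2 9, Add 0 0 4, Load 1 0] (X, w) = (Y1, w)"
      using X adr mem by (auto simp: Y1_def fun_eq_iff)
    then have 1: "reaches P 7 (30, X, w) (37, Y1, w)"
      by (intro reaches_block[OF code(1)]) simp_all
    have Y1: "Y1 9 = ev ?s" "Y1 13 = s0" "Y1 7 = 0" "Y1 2 = 34 + 3 * k" "Y1 12 = 3" "Y1 3 = Suc n" "Y1 4 = 1"
      "Y1 1 = X (33 + 3 * ?s)" using X by (simp_all add: Y1_def)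
    define Y2 where "Y2 = Y1(1 := st (Suc k))"
    have 2: "reaches P 9 (30, X, w) (39, Y2, w)"
    proof (cases "ev ?s = 0")
      case True
      have "reaches P 1 (38, Y1, w) (39, Y2, w)"
        using reaches_instr[OF code(3), of Y1 w] True Y1 st[of k] by (simp add: Y2_def)
      from reaches_trans[OF reaches_trans[OF 1 reaches_jump[OF code(2)]], of 1 "(39, Y2, w)"] this
      show ?thesis using True Y1 by simp
    next
      case False
      have "Y2 = Y1" using False Y1 st[of k] X(10) by (auto simp: Y2_def fun_eq_iff)
      then have "reaches P (7 + 1) (30, X, w) (39, Y2, w)"
        using reaches_trans[OF 1 reaches_jump[OF code(2)]] False Y1 by simp
      then show ?thesis by (rule reaches_mono) simp
    qed
    have "fold effect [Add 2 2 12, Sub 3 3 4] (Y2, w) = (Y, w)"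
      using Y1 by (auto simp: Y_def Y2_def fun_eq_iff)
    then have "reaches P 2 (39, Y2, w) (41, Y, w)"
      by (intro reaches_block[OF code(4)]) simp_all
    from reaches_trans[OF reaches_trans[OF 2 this] reaches_jump[OF code(5)]]
    have r: "reaches P 12 (30, X, w) (if n = 0 then 42 else 30, Y, w)"
      by (cases "n = 0") (simp_all add: Y_def)
    have keep: "\<forall>a. 4 \<le> a \<and> a < 32 \<and> a \<noteq> 9 \<longrightarrow> Y a = X a" by (simp add: Y_def Y1_def)
    have tab: "Y (32 + 3 * s) = X (32 + 3 * s)" "Y (33 + 3 * s) = X (33 + 3 * s)" for s
    proof -
      have "32 + 3 * s \<noteq> 34 + 3 * k" "33 + 3 * s \<noteq> 34 + 3 * k" by presburger+
      then show "Y (32 + 3 * s) = X (32 + 3 * s)" "Y (33 + 3 * s) = X (33 + 3 * s)"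
        by (simp_all add: Y_def Y1_def)
    qed
    have "Y (34 + 3 * j) = ev (st j)" if "j \<le> k" for j
      using that X(11) by (cases "j = k") (simp_all add: Y_def Y1_def)
    then show ?thesis using r keep tab by (intro exI[of _ Y] conjI allI impI) (simp_all add: Y_def)
  qed
  {
    case (0 X k)
    from iter[OF 0] show ?case by (elim exE conjE, intro exI conjI) (simp_all add: less_Suc_eq_le)
  next
    case (Suc n X k)
    from iter[OF Suc.prems] obtain Y where Y: "reaches P 12 (30, X, w) (30, Y, w)"
      "Y 3 = Suc n" "Y 1 = st (Suc k)" "Y 2 = 34 + 3 * Suc k"
      "\<forall>a. 4 \<le> a \<and> a < 32 \<and> a \<noteq> 9 \<longrightarrow> Y a = X a"
      "\<forall>s. Y (32 + 3 * s) = X (32 + 3 * s)" "\<forall>s. Y (33 + 3 * s) = X (33 + 3 * s)"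
      "\<forall>j \<le> k. Y (34 + 3 * j) = ev (st j)"
      by (elim exE conjE) simp
    have "\<exists>Z. reaches P (12 * Suc n) (30, Y, w) (42, Z, w) \<and>
      (\<forall>a. 4 \<le> a \<and> a < 32 \<and> a \<noteq> 9 \<longrightarrow> Z a = Y a) \<and> (\<forall>j < Suc k + Suc n. Z (34 + 3 * j) = ev (st j))"
      using Y Suc.prems by (intro Suc.IH) (simp_all add: less_Suc_eq_le)
    then obtain Z where Z: "reaches P (12 * Suc n) (30, Y, w) (42, Z, w)"
      "\<forall>a. 4 \<le> a \<and> a < 32 \<and> a \<noteq> 9 \<longrightarrow> Z a = Y a" "\<forall>j < Suc k + Suc n. Z (34 + 3 * j) = ev (st j)"
      by (elim exE conjE)
    have "reaches P (12 * Suc (Suc n)) (30, X, w) (42, Z, w)"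
      using reaches_trans[OF Y(1) Z(1)] by simp
    moreover have "\<forall>a. 4 \<le> a \<and> a < 32 \<and> a \<noteq> 9 \<longrightarrow> Z a = X a" using Z(2) Y(5) by simp
    moreover have "\<forall>j < k + Suc (Suc n). Z (34 + 3 * j) = ev (st j)" using Z(3) by simp
    ultimately show ?case by (intro exI[of _ Z] conjI)
  }
qed

lemma loader_correct:
  assumes code: "code_at P 0 loader"
    and w: "w = [length ss, length es, length as, s0] @ ss @ es @ concat (map (\<lambda>(s, e, s'). [s, e, s']) as)"
    and ss: "ss \<noteq> []" and dist: "distinct (map fst as)"
    and arcs: "\<forall>(s, e, s') \<in> set as. ev s = Suc e \<and> nx s = s'" "\<forall>s. s \<notin> fst ` set as \<longrightarrow> ev s = 0"
    and st: "st 0 = s0" "\<And>k. st (Suc k) = (if ev (st k) = 0 then s0 else nx (st k))"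
  obtains Y where "reaches P (30 * length w) (0, \<lambda>_. 0, w) (42, Y, [])"
    and "table (\<lambda>k. ev (st k)) (2 * length ss) 9 Y" and "Y 6 = length ss"
proof -
  note codes = loader_code[OF code]
  let ?as = "concat (map (\<lambda>(s, e, s'). [s, e, s']) as)"
  let ?m = "length ss"
  define X0 :: "nat \<Rightarrow> nat" where "X0 = (\<lambda>_. 0)(4 := 1, 8 := 34, 11 := 32, 12 := 3, 6 := length ss, 9 := length es,
    10 := length as, 13 := s0, 1 := length (ss @ es))"
  have 0: "reaches P 9 (0, \<lambda>_. 0, w) (9, X0, (ss @ es) @ ?as)"
    by (intro reaches_block[OF codes(1)]) (simp_all add: X0_def w)
  obtain X1 where 1: "reaches P (3 * length (ss @ es)) (9, X0, (ss @ es) @ ?as) (12, X1, ?as)"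
    and X1: "\<forall>a. a \<notin> {1, 2} \<longrightarrow> X1 a = X0 a"
    using skip_loop[OF codes(2,3), of X0 "ss @ es" ?as] ss by (auto simp: X0_def)
  have X1_eqs: "X1 10 = length as" "X1 4 = 1" "X1 11 = 32" "X1 12 = 3" "X1 8 = 34" "X1 6 = ?m" "X1 7 = 0" "X1 13 = s0"
    using X1 by (simp_all add: X0_def)
  have X1_0: "X1 (32 + 3 * s) = 0" for s using X1 by (simp add: X0_def)
  obtain X2 where 2: "reaches P (2 + 12 * length as) (12, X1, ?as) (26, X2, [])"
    and X2: "\<forall>a. 4 \<le> a \<and> a < 32 \<and> a \<noteq> 10 \<longrightarrow> X2 a = X1 a"
      "\<forall>(s, e, s') \<in> set as. X2 (32 + 3 * s) = Suc e \<and> X2 (33 + 3 * s) = s'"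
      "\<forall>s. s \<notin> fst ` set as \<longrightarrow> X2 (32 + 3 * s) = X1 (32 + 3 * s) \<and> X2 (33 + 3 * s) = X1 (33 + 3 * s)"
  proof (cases "as = []")
    case True
    have "reaches P (1 + 1) (12, X1, []) (26, X1, [])"
      using reaches_trans[OF reaches_jump[OF codes(4), of X1 "[]"], of 1 "(26, X1, [])"]
        reaches_jump[OF codes(5), of X1 "[]"] X1_eqs True by simp
    then show thesis using True by (intro that[of X1]) (simp_all add: numeral_2_eq_2)
  next
    case False
    obtain X2 where X2: "reaches P (12 * length as) (14, X1, ?as @ []) (26, X2, [])"
      "\<forall>a. 4 \<le> a \<and> a < 32 \<and> a \<noteq> 10 \<longrightarrow> X2 a = X1 a"
      "\<forall>(s, e, s') \<in> set as. X2 (32 + 3 * s) = Suc e \<and> X2 (33 + 3 * s) = s'"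
      "\<forall>s. s \<notin> fst ` set as \<longrightarrow> X2 (32 + 3 * s) = X1 (32 + 3 * s) \<and> X2 (33 + 3 * s) = X1 (33 + 3 * s)"
      using arc_loop[OF codes(6,7) X1_eqs(1) False X1_eqs(2,3) dist, of "[]"] by (elim exE conjE)
    have "reaches P 1 (12, X1, ?as) (14, X1, ?as)"
      using reaches_jump[OF codes(4), of X1 ?as] X1_eqs False by simp
    from reaches_trans[OF this] X2(1) have "reaches P (1 + 12 * length as) (12, X1, ?as) (26, X2, [])"
      by simp
    then have "reaches P (2 + 12 * length as) (12, X1, ?as) (26, X2, [])"
      by (rule reaches_mono) simp
    then show thesis using X2(2-) by (rule that)
  qed
  have ev: "X2 (32 + 3 * s) = ev s" "ev s \<noteq> 0 \<longrightarrow> X2 (33 + 3 * s) = nx s" for s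
  proof -
    have "X2 (32 + 3 * s) = ev s \<and> (ev s \<noteq> 0 \<longrightarrow> X2 (33 + 3 * s) = nx s)"
    proof (cases "s \<in> fst ` set as")
      case True
      then obtain e s' where "(s, e, s') \<in> set as" by auto
      then show ?thesis using X2(2) arcs(1) by fastforce
    next
      case False
      then show ?thesis using X2(3) arcs(2) X1_0 by simp
    qed
    then show "X2 (32 + 3 * s) = ev s" "ev s \<noteq> 0 \<longrightarrow> X2 (33 + 3 * s) = nx s" by simp_all
  qed
  have X2_eqs: "X2 4 = 1" "X2 11 = 32" "X2 12 = 3" "X2 8 = 34" "X2 6 = ?m" "X2 7 = 0" "X2 13 = s0"
    using X2(1) X1_eqs by simp_all
  define X3 where "X3 = X2(5 := 2 * ?m, 1 := s0, 2 := 34, 3 := 2 * ?m)"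
  have 3: "reaches P 4 (26, X2, []) (30, X3, [])"
    by (intro reaches_block[OF codes(8)]) (use X2_eqs in \<open>auto simp: X3_def fun_eq_iff\<close>)
  obtain n where n: "2 * ?m = Suc n" using ss by (cases "2 * ?m") auto
  have "\<exists>Y. reaches P (12 * Suc n) (30, X3, []) (42, Y, []) \<and>
    (\<forall>a. 4 \<le> a \<and> a < 32 \<and> a \<noteq> 9 \<longrightarrow> Y a = X3 a) \<and> (\<forall>j < 0 + Suc n. Y (34 + 3 * j) = ev (st j))"
    by (rule walk_loop[where st = st and ev = ev and nx = nx and ?s0.0 = s0, OF codes(9-13) st(2)]) (use X2_eqs ev st(1) n in \<open>simp_all add: X3_def\<close>)
  then obtain Y where Y: "reaches P (12 * Suc n) (30, X3, []) (42, Y, [])"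
    "\<forall>a. 4 \<le> a \<and> a < 32 \<and> a \<noteq> 9 \<longrightarrow> Y a = X3 a" "\<forall>j < 0 + Suc n. Y (34 + 3 * j) = ev (st j)"
    by (elim exE conjE)
  note reaches_trans[OF reaches_trans[OF reaches_trans[OF reaches_trans[OF 0 1] 2] 3] Y(1)]
  \<comment> \<open>A state costs 3 steps for skipping it and 24 for two letters of the word, an
    event 3, an arc 12; the constant part is 15.\<close>
  moreover have "9 + 3 * length (ss @ es) + (2 + 12 * length as) + 4 + 12 * Suc n \<le> 30 * length w"
  proof -
    have "length ?as = 3 * length as" by (induction as) auto
    then show ?thesis unfolding n[symmetric] w by simp
  qed
  ultimately have "reaches P (30 * length w) (0, \<lambda>_. 0, w) (42, Y, [])"
    by (rule reaches_mono)
  moreover have "table (\<lambda>k. ev (st k)) (2 * ?m) 9 Y"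
    using Y(2,3) X2_eqs unfolding n by (simp add: table_def X3_def n)
  moreover have "Y 6 = ?m" using Y(2) X2_eqs by (simp add: X3_def)
  ultimately show thesis by (rule that)
qed

lemma length_le_input_size: "length w \<le> input_size w"
  by (induction w) (auto simp: input_size_def)

lemma halted_funpow: "halted P c \<Longrightarrow> (step P ^^ t) c = c"
  by (induction t) (auto simp: step_def)

lemma run_if_reaches:
  assumes "reaches P T (0, \<lambda>_. 0, w) c" "halted P c" "T \<le> T'"
  shows "run P w T' = c"
proof -
  obtain t where t: "t \<le> T" "(step P ^^ t) (0, \<lambda>_. 0, w) = c"
    using assms(1) by (auto simp: reaches_def)
  have "T' = (T' - t) + t" using t assms(3) by simp
  then have "run P w T' = (step P ^^ (T' - t)) ((step P ^^ t) (0, \<lambda>_. 0, w))"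
    unfolding run_def by (metis funpow_add o_apply)
  then show ?thesis using t(2) halted_funpow[OF assms(2)] by simp
qed

text \<open>State names serve as addresses and never as loop counters; all loops are governed by
  lengths of lists or by \<open>2 * m\<close>. So the time is polynomial in the number of input
  entries, however large the names are.\<close>

lemma poly_time_decidable_if_fm:
  assumes f: "wff 9 f"
    and I: "\<And>A. A \<in> I \<Longrightarrow> one_bounded A"
    and Q: "\<And>A X. A \<in> I \<Longrightarrow> X 7 = 0 \<Longrightarrow> X 6 = card (states A) \<Longrightarrow>
      Q A \<longleftrightarrow> sat (word A) (2 * card (states A)) X f"
  shows "poly_time_decidable ts_encoding I Q"
proof -
  define P where "P = loader @ compile f 42"
  \<comment> \<open>The quantifiers range below \<open>2 * m\<close>, and \<open>m\<close> is at
    most the input size, hence the composition with \<open>[:0, 2:]\<close>.\<close>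
  define p where "p = [:0, 30:] + pcompose (cost f) [:0, 2:]"
  have code: "code_at P 0 loader" "code_at P 42 (compile f 42)"
    using code_at_self[of P] by (simp_all add: P_def length_loader)
  have len: "42 + length (compile f 42) = length P" by (simp add: P_def length_loader)
  have "let c = run P w (poly p (input_size w)) in halted P c \<and> (accepting c \<longleftrightarrow> Q A)"
    if AI: "A \<in> I" and enc: "ts_encoding A w" for A w
  proof -
    interpret one_bounded A using I AI by blast
    obtain ss es as where ss: "distinct ss" "set ss = states A" and as: "set as = arcs A" "distinct as"
      and w: "w = [length ss, length es, length as, init A] @ ss @ es @
        concat (map (\<lambda>(s, e, s'). [s, e, s']) as)"
      using enc unfolding ts_encoding_def by blast
    have m: "length ss = m" using distinct_card[OF ss(1)] ss(2) by simp
    then have "ss \<noteq> []" using m_pos by auto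
    have arc: "(s, e, s') \<in> set as \<longleftrightarrow> label A s = Suc e \<and> s' = next_state A s" for s e s'
      by (simp add: as(1) arcs_def arc_iff)
    have "inj_on fst (set as)" by (auto simp: inj_on_def arc)
    then have dist: "distinct (map fst as)" using as(2) by (simp add: distinct_map)
    have arcs: "\<forall>(s, e, s') \<in> set as. label A s = Suc e \<and> next_state A s = s'" by (auto simp: arc)
    have lab: "\<forall>s. s \<notin> fst ` set as \<longrightarrow> label A s = 0"
    proof (intro allI impI, rule ccontr)
      fix s assume s: "s \<notin> fst ` set as" "label A s \<noteq> 0"
      then have "(s, label A s - 1, next_state A s) \<in> set as" by (simp add: arc)
      then show False using s(1) by force
    qed
    have st: "walk A 0 = init A"
      "\<And>k. walk A (Suc k) = (if label A (walk A k) = 0 then init A else next_state A (walk A k))"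
      by (simp_all add: walk_def label_0)
    obtain X where X: "reaches P (30 * length w) (0, \<lambda>_. 0, w) (42, X, [])"
      "table (\<lambda>k. label A (walk A k)) (2 * length ss) 9 X" "X 6 = length ss"
      by (rule loader_correct[OF code(1) w \<open>ss \<noteq> []\<close> dist arcs lab st])
    have tab: "table (word A) (2 * m) 9 X" using X(2) unfolding word_def m .
    obtain Y where Y: "reaches P (poly (cost f) (2 * m)) (42, X, []) (length P, Y, [])"
      "Y 0 > 0 \<longleftrightarrow> sat (word A) (2 * m) X f"
      using compile_correct[OF code(2) f tab, of "[]"] m_pos unfolding len by auto
    have "m \<le> input_size w" using length_le_input_size[of w] m unfolding w by simp
    then have "poly (cost f) (2 * m) \<le> poly (cost f) (2 * input_size w)" by (intro poly_nat_mono) simp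
    then have "30 * length w + poly (cost f) (2 * m) \<le> poly p (input_size w)"
      using length_le_input_size[of w] by (simp add: p_def poly_pcompose mult.commute)
    then have run: "run P w (poly p (input_size w)) = (length P, Y, [])"
      by (intro run_if_reaches[OF reaches_trans[OF X(1) Y(1)]]) (simp_all add: halted_def)
    have "Q A \<longleftrightarrow> Y 0 > 0" using Q[OF AI, of X] Y(2) tab X(3) m by (simp add: table_def)
    then show ?thesis unfolding run by (simp add: Let_def halted_def accepting_def)
  qed
  then show ?thesis unfolding poly_time_decidable_def by blast
qed

section \<open>The criterion as a bounded formula\<close>

definition Disj :: "fm \<Rightarrow> fm \<Rightarrow> fm" where "Disj f g = Neg (Conj (Neg f) (Neg g))"
definition Imp :: "fm \<Rightarrow> fm \<Rightarrow> fm" where "Imp f g = Neg (Conj f (Neg g))"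
definition All :: "nat \<Rightarrow> fm \<Rightarrow> fm" where "All r f = Neg (Exists r (Neg f))"

lemma sat_derived [simp]:
  "sat W L v (Disj f g) \<longleftrightarrow> sat W L v f \<or> sat W L v g"
  "sat W L v (Imp f g) \<longleftrightarrow> (sat W L v f \<longrightarrow> sat W L v g)"
  "sat W L v (All r f) \<longleftrightarrow> (\<forall>x<L. sat W L (v(r := x)) f)"
  by (simp_all add: Disj_def Imp_def All_def)

lemma wff_derived [simp]:
  "wff d (Disj f g) \<longleftrightarrow> wff d f \<and> wff d g"
  "wff d (Imp f g) \<longleftrightarrow> wff d f \<and> wff d g"
  "wff d (All r f) \<longleftrightarrow> wff d (Exists r f)"
  by (simp_all add: Disj_def Imp_def All_def)

definition truth :: "bool \<Rightarrow> fm" where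
  "truth b = (if b then Neg (Less 7 7) else Less 7 7)"

text \<open>Variables 9, 10, 11 stand for \<open>d\<close>, \<open>k\<close>, \<open>k + d\<close>;
  7 holds 0 and 6 holds \<open>m\<close>. The sum stays below \<open>2 * m\<close>, within the range
  of its quantifier.\<close>

definition primitive_fm :: fm where
  "primitive_fm = All 9 (Imp (Conj (Less 7 9) (Less 9 6))
    (Exists 10 (Conj (Less 10 6) (Exists 11 (Conj (Sum 10 9 11) (Neg (Same 11 10)))))))"

text \<open>From here on, the variables 9, 10, 11 stand for \<open>j\<close>, a position of the letter \<open>a\<close>, and \<open>i\<close>
  in \<^const>\<open>inhibitor\<close>.\<close>

definition free_fm :: "bool \<Rightarrow> bool \<Rightarrow> fm" where
  "free_fm Z R = All 12 (All 13 (Imp (Conj (Less 12 13)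
      (Conj (Disj (Same 12 11) (Conj (truth Z) (Same 12 10)))
            (Disj (Same 13 10) (Conj (truth (\<not> R)) (Same 13 11)))))
    (Exists 14 (Conj (Conj (Less 12 14) (Less 14 13))
      (All 15 (Imp (Conj (Less 11 15) (Less 15 9)) (Neg (Same 15 14))))))))"

definition inhibitor_fm :: "bool \<Rightarrow> bool \<Rightarrow> bool \<Rightarrow> fm" where
  "inhibitor_fm R I U = Conj (Less 11 9) (Conj
     (All 12 (Imp (Conj (Less 11 12) (Less 12 9)) (Conj (Neg (Same 11 12)) (Neg (Same 10 12)))))
     (Disj (Conj (truth I) (free_fm True R))
           (Conj (truth U) (Conj (Neg (Same 11 10)) (free_fm False R)))))"

definition solvable_fm :: "bool \<Rightarrow> bool \<Rightarrow> bool \<Rightarrow> fm" where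
  "solvable_fm R I U = Conj primitive_fm
     (All 9 (All 10 (Imp (Conj (Neg (Less 9 6)) (Conj (Neg (Null 10)) (Neg (Same 9 10))))
       (Exists 11 (inhibitor_fm R I U)))))"

lemma sat_truth [simp]: "sat W L v (truth b) \<longleftrightarrow> b"
  by (simp add: truth_def)

lemma wff_truth [simp]: "wff d (truth b) \<longleftrightarrow> 7 < d"
  by (simp add: truth_def)

lemma wff_solvable_fm: "wff 9 (solvable_fm R I U)"
  by (simp add: solvable_fm_def primitive_fm_def inhibitor_fm_def free_fm_def)

lemma sat_primitive_fm:
  assumes "v 7 = 0" "v 6 = m" "L = 2 * m"
  shows "sat W L v primitive_fm \<longleftrightarrow> primitive_word W m"
proof -
  have "sat W L v primitive_fm \<longleftrightarrow>
    (\<forall>d<L. 0 < d \<and> d < m \<longrightarrow> (\<exists>k<L. k < m \<and> (\<exists>l<L. k + d = l \<and> W l \<noteq> W k)))"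
    by (simp add: primitive_fm_def assms(1,2))
  also have "\<dots> \<longleftrightarrow> (\<forall>d. 0 < d \<and> d < m \<longrightarrow> (\<exists>k<m. W (k + d) \<noteq> W k))"
  proof -
    have "(\<exists>k<L. k < m \<and> (\<exists>l<L. k + d = l \<and> W l \<noteq> W k)) \<longleftrightarrow> (\<exists>k<m. W (k + d) \<noteq> W k)" if "d < m" for d
    proof -
      have "k < L" "k + d < L" if "k < m" for k using that \<open>d < m\<close> assms(3) by simp_all
      then show ?thesis by blast
    qed
    moreover have "d < L" if "d < m" for d using that assms(3) by simp
    ultimately show ?thesis by meson
  qed
  finally show ?thesis unfolding primitive_word_def .
qed

text \<open>Variables 12 and 13 are the ends of a possible factor, 14 is a position between them
  whose letter is outside \<open>Y\<close>, and 15 runs over the occurrences that define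
  \<open>Y\<close>. That set is never stored, as \<open>i\<close> and \<open>j\<close> determine
  it.\<close>

lemma sat_free_fm:
  assumes "v 9 < L"
  shows "sat W L v (free_fm Z R) \<longleftrightarrow>
    factor_free W L (if Z then {W (v 11), W (v 10)} else {W (v 11)}) (between W (v 11) (v 9))
      (if R then {W (v 10)} else {W (v 11), W (v 10)})"
proof -
  let ?Y = "between W (v 11) (v 9)"
  let ?D = "if R then {W (v 10)} else {W (v 11), W (v 10)}"
  have sub: "(\<exists>r<L. (p < r \<and> r < q) \<and> (\<forall>t<L. v 11 < t \<and> t < v 9 \<longrightarrow> W t \<noteq> W r)) \<longleftrightarrow>
    \<not> between W p q \<subseteq> ?Y" (is "?l \<longleftrightarrow> ?r") if "q < L" for p q
  proof
    assume ?l
    then obtain r where r: "p < r" "r < q" "\<forall>t<L. v 11 < t \<and> t < v 9 \<longrightarrow> W t \<noteq> W r" by blast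
    then have "W r \<in> between W p q" unfolding between_def by blast
    moreover have "W r \<notin> ?Y"
    proof
      assume "W r \<in> ?Y"
      then obtain t where "W r = W t" "v 11 < t" "t < v 9" unfolding between_def by blast
      then show False using r(3)[rule_format, of t] assms by simp
    qed
    ultimately show ?r by blast
  next
    assume ?r
    then obtain r where r: "p < r" "r < q" "W r \<notin> ?Y" unfolding between_def by blast
    have "W t \<noteq> W r" if "v 11 < t" "t < v 9" for t
    proof
      assume "W t = W r"
      then have "W r \<in> ?Y" using that unfolding between_def by (metis (mono_tags, lifting) mem_Collect_eq)
      then show False using r(3) by simp
    qed
    then show ?l using r(1,2) \<open>q < L\<close> by (intro exI[of _ r]) auto
  qed
  have "sat W L v (free_fm Z R) \<longleftrightarrow> (\<forall>p<L. \<forall>q<L.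
    p < q \<and> (W p = W (v 11) \<or> Z \<and> W p = W (v 10)) \<and> (W q = W (v 10) \<or> \<not> R \<and> W q = W (v 11)) \<longrightarrow>
    (\<exists>r<L. (p < r \<and> r < q) \<and> (\<forall>t<L. v 11 < t \<and> t < v 9 \<longrightarrow> W t \<noteq> W r)))"
    by (simp add: free_fm_def)
  also have "\<dots> \<longleftrightarrow> (\<forall>p<L. \<forall>q<L.
    p < q \<and> W p \<in> (if Z then {W (v 11), W (v 10)} else {W (v 11)}) \<and> W q \<in> ?D \<longrightarrow>
    \<not> between W p q \<subseteq> ?Y)"
  proof -
    have "W p \<in> (if Z then {W (v 11), W (v 10)} else {W (v 11)}) \<longleftrightarrow>
      W p = W (v 11) \<or> Z \<and> W p = W (v 10)" for p by simp
    moreover have "W q \<in> ?D \<longleftrightarrow> W q = W (v 10) \<or> \<not> R \<and> W q = W (v 11)" for q by auto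
    ultimately show ?thesis by (simp only: sub cong: imp_cong)
  qed
  also have "\<dots> \<longleftrightarrow> factor_free W L (if Z then {W (v 11), W (v 10)} else {W (v 11)}) ?Y ?D"
    unfolding factor_free_def by (meson order_less_trans)
  finally show ?thesis .
qed

lemma sat_inhibitor_fm:
  assumes "v 9 < L"
  shows "sat W L v (inhibitor_fm R I U) \<longleftrightarrow> inhibitor R I U W L (v 11) (v 9) (W (v 10))"
proof -
  have between: "(\<forall>t<L. v 11 < t \<and> t < v 9 \<longrightarrow> W (v 11) \<noteq> W t \<and> W (v 10) \<noteq> W t) \<longleftrightarrow>
    W (v 11) \<notin> between W (v 11) (v 9) \<and> W (v 10) \<notin> between W (v 11) (v 9)"
  proof -
    have "t < L" if "t < v 9" for t using that assms by simp
    then have "c \<notin> between W (v 11) (v 9) \<longleftrightarrow> (\<forall>t<L. v 11 < t \<and> t < v 9 \<longrightarrow> c \<noteq> W t)" for c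
      unfolding between_def by blast
    then show ?thesis by blast
  qed
  have "sat W L v (inhibitor_fm R I U) \<longleftrightarrow> v 11 < v 9 \<and>
    (\<forall>t<L. v 11 < t \<and> t < v 9 \<longrightarrow> W (v 11) \<noteq> W t \<and> W (v 10) \<noteq> W t) \<and>
    (I \<and> sat W L v (free_fm True R) \<or> U \<and> W (v 11) \<noteq> W (v 10) \<and> sat W L v (free_fm False R))"
    unfolding inhibitor_fm_def by simp
  then show ?thesis unfolding between sat_free_fm[of v L, OF assms] inhibitor_def by simp
qed

lemma sat_solvable_fm:
  assumes "v 7 = 0" "v 6 = m" "L = 2 * m"
  shows "sat W L v (solvable_fm R I U) \<longleftrightarrow> primitive_word W m \<and>
    (\<forall>j k. m \<le> j \<and> j < L \<and> k < L \<and> W k \<noteq> 0 \<and> W j \<noteq> W k \<longrightarrow>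
      (\<exists>i. inhibitor R I U W L i j (W k)))"
proof -
  have inner: "(\<exists>i<L. sat W L (v(9 := j, 10 := k, 11 := i)) (inhibitor_fm R I U)) \<longleftrightarrow>
    (\<exists>i. inhibitor R I U W L i j (W k))" if "j < L" for j k
  proof -
    have "sat W L (v(9 := j, 10 := k, 11 := i)) (inhibitor_fm R I U) \<longleftrightarrow> inhibitor R I U W L i j (W k)" for i
      using that by (subst sat_inhibitor_fm) simp_all
    \<comment> \<open>Since \<open>i < j < L\<close>, bounding the quantifier loses no
      witness.\<close>
    moreover have "i < L" if "inhibitor R I U W L i j (W k)" for i
      using that \<open>j < L\<close> by (simp add: inhibitor_def)
    ultimately show ?thesis by blast
  qed
  have "sat W L v (solvable_fm R I U) \<longleftrightarrow> primitive_word W m \<and>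
    (\<forall>j<L. \<forall>k<L. \<not> j < m \<and> W k \<noteq> 0 \<and> W j \<noteq> W k \<longrightarrow>
      (\<exists>i<L. sat W L (v(9 := j, 10 := k, 11 := i)) (inhibitor_fm R I U)))"
    by (simp add: solvable_fm_def sat_primitive_fm[OF assms] assms(2))
  also have "\<dots> \<longleftrightarrow> primitive_word W m \<and>
    (\<forall>j<L. \<forall>k<L. \<not> j < m \<and> W k \<noteq> 0 \<and> W j \<noteq> W k \<longrightarrow>
      (\<exists>i. inhibitor R I U W L i j (W k)))"
    by (intro conj_cong iff_allI imp_cong refl inner)
  finally show ?thesis unfolding not_less by blast
qed

lemma poly_time_decidable_tau_solvable:
  assumes flags: "inhibition_flags \<tau> R I U"
    and nop: "Nop \<in> \<tau>"
    and up: "u \<in> \<tau>" "interact u False = Some True" and down: "d \<in> \<tau>" "interact d True = Some False"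
    and noswap: "Swap \<notin> \<tau>" and inh: "c \<in> \<tau>" "interact c b = None"
    and g: "g < 2"
  shows "poly_time_decidable ts_encoding {A :: (nat, nat) ts. transition_system A \<and> bounded g A}
           (tau_solvable \<tau>)"
proof (rule poly_time_decidable_if_fm[OF wff_solvable_fm[of R I U]])
  fix A :: "(nat, nat) ts" assume "A \<in> {A. transition_system A \<and> bounded g A}"
  then have A: "transition_system A" and "bounded g A" by simp_all
  then have "bounded 1 A" using g unfolding bounded_def by fastforce
  then show "one_bounded A" using A by unfold_locales
  then interpret one_bounded A .
  fix X :: "nat \<Rightarrow> nat" assume X: "X 7 = 0" "X 6 = m"
  have "word_inhibits \<tau> (word A) m j (word A k) \<longleftrightarrow> (\<exists>i. inhibitor R I U (word A) (2 * m) i j (word A k))"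
    if "m \<le> j" for j k
    using flags[unfolded inhibition_flags_def] word_period m_pos that by blast
  then show "tau_solvable \<tau> A \<longleftrightarrow> sat (word A) (2 * m) X (solvable_fm R I U)"
    unfolding sat_solvable_fm[OF X refl] solvable_iff_word[OF nop up down noswap inh] by blast
qed

theorem theorem9:
  fixes g :: nat and \<tau> :: "interaction set"
  assumes "g < 2"
    and "\<tau> = {Nop, Inp, Set} \<or> \<tau> = {Nop, Inp, Set, Used} \<or>
         \<tau> = {Nop, Out, Res} \<or> \<tau> = {Nop, Out, Res, Free} \<or>
         (\<exists>\<omega>. \<omega> \<noteq> {} \<and> \<omega> \<subseteq> {Inp, Out, Used, Free} \<and> \<tau> = {Nop, Set, Res} \<union> \<omega>)"
  shows "poly_time_decidable ts_encoding
           {A :: (nat, nat) ts. transition_system A \<and> bounded g A}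
           (tau_solvable \<tau>)"
proof -
  consider "\<tau> = {Nop, Inp, Set} \<or> \<tau> = {Nop, Inp, Set, Used}"
    | "\<tau> = {Nop, Out, Res} \<or> \<tau> = {Nop, Out, Res, Free}"
    | \<omega> where "\<omega> \<noteq> {}" "\<omega> \<subseteq> {Inp, Out, Used, Free}" "\<tau> = {Nop, Set, Res} \<union> \<omega>"
    using assms(2) by blast
  then show ?thesis
  proof cases
    case 1
    have "inhibition_flags \<tau> False True (Used \<in> \<tau>)"
      using 1 by (intro inhibition_flags_no_res) auto
    then show ?thesis
      by (rule poly_time_decidable_tau_solvable[where u = Set and d = Inp and c = Inp and b = False])
        (use 1 assms(1) in auto)
  next
    case 2
    \<comment> \<open>Complementing turns these types into the previous ones. Only the flags are
      transferred; solvability is still decided for \<open>\<tau>\<close> itself.\<close>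
    have "inhibition_flags (dual ` \<tau>) False True (Used \<in> dual ` \<tau>)"
      using 2 by (intro inhibition_flags_no_res) auto
    then have "inhibition_flags \<tau> False True (Used \<in> dual ` \<tau>)"
      by (simp only: inhibition_flags_dual)
    then show ?thesis
      by (rule poly_time_decidable_tau_solvable[where u = Out and d = Res and c = Out and b = True])
        (use 2 assms(1) in auto)
  next
    case 3
    then obtain c where c: "c \<in> \<omega>" by blast
    then have "c = Inp \<or> c = Out \<or> c = Used \<or> c = Free" using 3(2) by blast
    \<comment> \<open>\<open>Out\<close> and \<open>Free\<close> are undefined at 1,
      \<open>Inp\<close> and \<open>Used\<close> at 0.\<close>
    then have "interact c (c = Out \<or> c = Free) = None" by auto
    then obtain b where "interact c b = None" by blast
    with inhibition_flags_res[OF 3(3,2)] show ?thesis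
      by (intro poly_time_decidable_tau_solvable[where u = Set and d = Res and c = c and b = b])
        (use 3 c assms(1) in auto)
  qed
qed

end
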